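(* For any integers $n\ge 0$ and $k\ge 2$, there is a piecewise linear map whose Lyapunov spectrum $L$ has at least $n$ points (in the interior of its domain) at which its $k$-th order derivative vanishes.
   Context: Piecewise linear map: given an integer $q\ge 2$ and pairwise disjoint closed sub-intervals $X_1,\dots,X_q$ of $[0,1]$ with lengths $|X_i|>0$, a piecewise linear map with $q$ branches is a map $T:\bigcup_{i=1}^q X_i\to[0,1]$ whose restriction to each $X_i$ is an affine homeomorphism onto $[0,1]$ (so $|T'|=|X_i|^{-1}$ on $X_i$). Its invariant set is $X=\{x\in[0,1]:T^n(x)\in\bigcup_{i=1}^q X_i\text{ for all }n\ge0\}$, and $T$ is regarded as a dynamical system $T:X\to X$. Lyapunov spectrum: for $x\in X$ let $\lambda(x)=\lim_{n\to\infty}\frac1n\log|(T^n)'(x)|$ whenever this limit exists. The set $A$ of all values taken by $\lambda$ is a closed interval $[\alpha_{\min},\alpha_{\max}]$. The Lyapunov spectrum is $L:A\to\mathbb{R}$, $L(\alpha)=\dim_H\{x\in X:\lambda(x)\text{ exists and equals }\alpha\}$, where $\dim_H$ is Hausdorff dimension. $L$ is real analytic on the interior $(\alpha_{\min},\alpha_{\max})$ of its domain. *)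

theory Defs
  imports "HOL-Analysis.Analysis"
begin

section \<open>Hausdorff dimension\<close>

text \<open>
  The \<open>s\<close>-th power of the diameter, with the usual conventions for \<open>s = 0\<close>: every nonempty
  set contributes \<open>1\<close> (whereas \<open>0 powr 0 = 0\<close>), the empty set contributes \<open>0\<close>.
\<close>

definition diam_pow :: "real \<Rightarrow> 'a::metric_space set \<Rightarrow> ennreal" where
  "diam_pow s U = (if U = {} then 0 else if s = 0 then 1 else ennreal (diameter U powr s))"

text \<open>
  Boundedness of the covering sets must be required explicitly, since \<^const>\<open>diameter\<close> is
  unspecified on unbounded sets. Finite covers are included, as the \<open>U i\<close> may be empty.
\<close>

definition hausdorff_premeasure :: "real \<Rightarrow> real \<Rightarrow> 'a::metric_space set \<Rightarrow> ennreal" where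
  "hausdorff_premeasure s \<delta> E =
     (INF U \<in> {U :: nat \<Rightarrow> 'a set. E \<subseteq> (\<Union>i. U i) \<and> (\<forall>i. bounded (U i) \<and> diameter (U i) \<le> \<delta>)}.
        (\<Sum>i. diam_pow s (U i)))"

definition hausdorff_measure :: "real \<Rightarrow> 'a::metric_space set \<Rightarrow> ennreal" where
  "hausdorff_measure s E = (SUP \<delta> \<in> {0<..}. hausdorff_premeasure s \<delta> E)"

definition hausdorff_dim :: "'a::metric_space set \<Rightarrow> ennreal" where
  "hausdorff_dim E = Inf {ennreal s | s. 0 \<le> s \<and> hausdorff_measure s E = 0}"


section \<open>Piecewise linear maps\<close>

text \<open>
  The map is only meant to be defined on the union of the branch intervals \<open>X 1, \<dots>, X q\<close>.
  The values of the total function \<open>T\<close> elsewhere are arbitrary and are never used below.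
\<close>

definition piecewise_linear_map :: "nat \<Rightarrow> (nat \<Rightarrow> real set) \<Rightarrow> (real \<Rightarrow> real) \<Rightarrow> bool" where
  "piecewise_linear_map q X T \<longleftrightarrow>
     q \<ge> 2 \<and>
     (\<forall>i\<in>{1..q}. \<exists>a b. 0 \<le> a \<and> a < b \<and> b \<le> 1 \<and> X i = {a..b}) \<and>
     disjoint_family_on X {1..q} \<and>
     (\<forall>i\<in>{1..q}. (\<exists>c d. \<forall>x\<in>X i. T x = c * x + d) \<and> (\<exists>g. homeomorphism (X i) {0..1} T g))"

definition iterate_domain :: "nat \<Rightarrow> (nat \<Rightarrow> real set) \<Rightarrow> (real \<Rightarrow> real) \<Rightarrow> nat \<Rightarrow> real set" where
  "iterate_domain q X T n = {x \<in> {0..1}. \<forall>m<n. (T ^^ m) x \<in> (\<Union>i\<in>{1..q}. X i)}"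

definition invariant_set :: "nat \<Rightarrow> (nat \<Rightarrow> real set) \<Rightarrow> (real \<Rightarrow> real) \<Rightarrow> real set" where
  "invariant_set q X T = {x \<in> {0..1}. \<forall>n. (T ^^ n) x \<in> (\<Union>i\<in>{1..q}. X i)}"

text \<open>
  The derivative of \<open>T\<^sup>n\<close> is taken relative to the domain of \<open>T\<^sup>n\<close>, a finite union of
  nondegenerate compact intervals; at an endpoint of one of these it is one-sided.
\<close>

definition iterate_deriv :: "nat \<Rightarrow> (nat \<Rightarrow> real set) \<Rightarrow> (real \<Rightarrow> real) \<Rightarrow> nat \<Rightarrow> real \<Rightarrow> real" where
  "iterate_deriv q X T n x = vector_derivative (T ^^ n) (at x within iterate_domain q X T n)"


section \<open>Lyapunov spectrum\<close>

definition has_lyapunov_exponent ::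
    "nat \<Rightarrow> (nat \<Rightarrow> real set) \<Rightarrow> (real \<Rightarrow> real) \<Rightarrow> real \<Rightarrow> real \<Rightarrow> bool" where
  "has_lyapunov_exponent q X T x \<alpha> \<longleftrightarrow>
     (\<lambda>n. 1 / real n * ln \<bar>iterate_deriv q X T n x\<bar>) \<longlonglongrightarrow> \<alpha>"

definition lyapunov_values :: "nat \<Rightarrow> (nat \<Rightarrow> real set) \<Rightarrow> (real \<Rightarrow> real) \<Rightarrow> real set" where
  "lyapunov_values q X T = {\<alpha>. \<exists>x\<in>invariant_set q X T. has_lyapunov_exponent q X T x \<alpha>}"

text \<open>
  Only the values at points of \<^const>\<open>lyapunov_values\<close> are meaningful. There the dimension is
  that of a subset of \<open>[0,1]\<close>, hence finite, and \<^const>\<open>enn2real\<close> loses nothing.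
\<close>

definition lyapunov_spectrum ::
    "nat \<Rightarrow> (nat \<Rightarrow> real set) \<Rightarrow> (real \<Rightarrow> real) \<Rightarrow> real \<Rightarrow> real" where
  "lyapunov_spectrum q X T \<alpha> =
     enn2real (hausdorff_dim {x \<in> invariant_set q X T. has_lyapunov_exponent q X T x \<alpha>})"

text \<open>
  The points of the open set \<open>S\<close> at which the \<open>k\<close>-th derivative of \<open>f\<close> vanishes. As
  \<^const>\<open>deriv\<close> is unspecified where a function is not differentiable, the existence of the
  derivatives up to order \<open>k\<close> on \<open>S\<close> is part of the definition.
\<close>

definition deriv_zeros :: "nat \<Rightarrow> (real \<Rightarrow> real) \<Rightarrow> real set \<Rightarrow> real set" where
  "deriv_zeros k f S =
     {x \<in> S. (\<forall>j<k. \<forall>y\<in>S. (deriv ^^ j) f differentiable at y) \<and> (deriv ^^ k) f x = 0}"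

end

theory Submission
  imports Defs "HOL-Probability.Probability"
begin

text \<open>
  The spectrum of a piecewise linear map with branch lengths \<open>exp (- a i)\<close> is, on the interior of
  its domain, \<open>L \<alpha> = h \<alpha> / \<alpha>\<close>, where the entropy \<open>h \<alpha>\<close> is the minimum over \<open>s\<close> of
  \<open>P s + s * \<alpha>\<close> and \<open>P s = ln (\<Sum>i. exp (- s * a i))\<close> is the pressure. If the exponents take
  values \<open>a\<close> with \<open>N a\<close> branches each and all these numbers are large, then \<open>h\<close> is close to
  the concave polygon with vertices \<open>(a, ln (N a))\<close>. Dividing by \<open>\<alpha>\<close> turns an edge
  \<open>c + e * \<alpha>\<close> with \<open>c > 0\<close> into the convex curve \<open>c / \<alpha> + e\<close>, while the vertices stay concave.
  Choosing the vertices so that the values \<open>ln (N a) / a\<close> lie on one straight line makes \<open>L\<close>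
  dip below this line inside every edge and come back to it at every vertex. The graph thus
  meets the line as often as desired, and since an affine function has no derivative of order
  \<open>k \<ge> 2\<close>, Rolle's theorem applied \<open>k\<close> times to the difference produces zeros of the \<open>k\<close>-th
  derivative (\<open>deriv_zeros_if_line_intersections\<close>, \<open>above_line\<close>, \<open>below_line\<close>).

  The formula for \<open>L\<close> rests on the Bernoulli measure whose weights \<open>exp (- s * a i - P s)\<close> have
  average exponent \<open>\<alpha>\<close>. On cylinders around points of Lyapunov exponent \<open>\<alpha>\<close>, the logarithms of
  mass and diameter have the ratio \<open>h \<alpha> / \<alpha>\<close> in the limit. Covering by these cylinders bounds the
  dimension from above (\<open>hausdorff_measure_level_eq_0\<close>). From below, the strong law of large
  numbers shows that the measure is carried by the level set, and the gaps between the branches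
  force a small set into a single small cylinder, so the measure is a mass distribution
  (\<open>hausdorff_measure_level_pos\<close>).

  Smoothness of \<open>L\<close> comes from the parametrisation by \<open>s\<close>: both \<open>\<alpha> = - P' s\<close> and \<open>L\<close> are
  elementary functions of \<open>s\<close>, and \<open>P''\<close> is a variance that never vanishes
  (\<open>dim_formula_smooth\<close>).
\<close>

section \<open>Zeros of higher derivatives\<close>

text \<open>
  Rolle's theorem between consecutive zeros. Enumerating the zeros by a strictly increasing
  sequence makes the iteration immediate: the new zeros interlace the old ones.
\<close>

lemma iterated_Rolle:
  fixes G :: "nat \<Rightarrow> real \<Rightarrow> real" and z :: "nat \<Rightarrow> real"
  assumes "is_interval I"
    and "\<And>j x. x \<in> I \<Longrightarrow> (G j has_real_derivative G (Suc j) x) (at x)"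
    and "\<And>i. i < N + k \<Longrightarrow> z i \<in> I \<and> G 0 (z i) = 0"
    and "\<And>i. Suc i < N + k \<Longrightarrow> z i < z (Suc i)"
  shows "\<exists>y. (\<forall>i<N. y i \<in> I \<and> G k (y i) = 0) \<and> (\<forall>i. Suc i < N \<longrightarrow> y i < y (Suc i))"
  using assms(2-)
proof (induction k arbitrary: G z)
  case 0
  then show ?case by auto
next
  case (Suc k)
  have "\<exists>y. Suc i < N + Suc k \<longrightarrow> z i < y \<and> y < z (Suc i) \<and> y \<in> I \<and> G 1 y = 0" for i
  proof (cases "Suc i < N + Suc k")
    case True
    have zi: "z i \<in> I" "z (Suc i) \<in> I" "z i < z (Suc i)" "G 0 (z i) = 0" "G 0 (z (Suc i)) = 0"
      using Suc.prems(2)[of i] Suc.prems(2)[of "Suc i"] Suc.prems(3)[of i] True by auto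
    have sub: "x \<in> I" if "z i \<le> x" "x \<le> z (Suc i)" for x
      using assms(1) zi that unfolding is_interval_1 by blast
    have "continuous_on {z i..z (Suc i)} (G 0)"
      by (intro continuous_at_imp_continuous_on ballI DERIV_isCont[OF Suc.prems(1)[OF sub]]) auto
    moreover have "(G 0 has_derivative (*) (G 1 x)) (at x)" if "z i < x" "x < z (Suc i)" for x
      using Suc.prems(1)[of x 0] sub[of x] that by (simp add: has_field_derivative_def)
    ultimately obtain y where y: "z i < y" "y < z (Suc i)" "(*) (G 1 y) = (\<lambda>v. 0)"
      using Rolle_deriv[of "z i" "z (Suc i)" "G 0" "\<lambda>x. (*) (G 1 x)"] zi by auto
    from fun_cong[OF y(3), of 1] y sub[of y] show ?thesis by auto
  qed auto
  then obtain y where y: "\<And>i. Suc i < N + Suc k \<Longrightarrow> z i < y i \<and> y i < z (Suc i) \<and> y i \<in> I \<and> G 1 (y i) = 0"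
    by metis
  have "y i < y (Suc i)" if "Suc i < N + k" for i
    using y[of i] y[of "Suc i"] that by auto
  with Suc.IH[of "\<lambda>j. G (Suc j)" y] Suc.prems(1) y show ?case by auto
qed

text \<open>
  Near each point of an open set the function agrees with the bottom of an explicit tower of
  derivatives \<open>G\<close>, so the iterates of \<^const>\<open>deriv\<close> climb this tower.
\<close>

lemma deriv_iterate_eq:
  fixes G :: "nat \<Rightarrow> real \<Rightarrow> real"
  assumes "open S"
    and deriv: "\<And>j x. x \<in> S \<Longrightarrow> (G j has_real_derivative G (Suc j) x) (at x)"
    and "\<And>x. x \<in> S \<Longrightarrow> f x = G 0 x"
  shows "x \<in> S \<Longrightarrow> (deriv ^^ j) f x = G j x"
    and "x \<in> S \<Longrightarrow> (deriv ^^ j) f differentiable (at x)"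
proof -
  have *: "((deriv ^^ j) f has_real_derivative G (Suc j) x) (at x)"
    if "x \<in> S" "\<And>y. y \<in> S \<Longrightarrow> (deriv ^^ j) f y = G j y" for x j
    by (rule has_field_derivative_transform_within_open[OF deriv[OF that(1)] \<open>open S\<close>])
      (use that in auto)
  have eq: "\<forall>x\<in>S. (deriv ^^ j) f x = G j x" for j
  proof (induction j)
    case (Suc j)
    then show ?case using * by (auto intro: DERIV_imp_deriv)
  qed (use assms in auto)
  show "x \<in> S \<Longrightarrow> (deriv ^^ j) f x = G j x" using eq by auto
  show "x \<in> S \<Longrightarrow> (deriv ^^ j) f differentiable (at x)"
    using *[of x j] eq by (auto simp: real_differentiable_def)
qed

text \<open>
  Subtracting an affine function changes no derivative of order \<open>k \<ge> 2\<close>, so many intersections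
  of the graph with one line force many zeros of the \<open>k\<close>-th derivative.
\<close>

lemma deriv_zeros_if_line_intersections:
  fixes G :: "nat \<Rightarrow> real \<Rightarrow> real" and z :: "nat \<Rightarrow> real"
  assumes S: "open S" "is_interval S"
    and deriv: "\<And>j x. x \<in> S \<Longrightarrow> (G j has_real_derivative G (Suc j) x) (at x)"
    and f: "\<And>x. x \<in> S \<Longrightarrow> f x = G 0 x"
    and "2 \<le> k"
    and z: "\<And>i. i < n + k \<Longrightarrow> z i \<in> S \<and> f (z i) = A + B * z i"
    and mono: "\<And>i. Suc i < n + k \<Longrightarrow> z i < z (Suc i)"
  shows "\<exists>Z. finite Z \<and> card Z = n \<and> Z \<subseteq> deriv_zeros k f S"
proof -
  define E where "E j x = (if j = 0 then A + B * x else if j = 1 then B else 0)"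
    for j :: nat and x :: real
  have E: "(E j has_real_derivative E (Suc j) x) (at x)" for j x
  proof -
    have "((\<lambda>x. A + B * x) has_real_derivative B) (at x)"
      by (auto intro!: derivative_eq_intros)
    moreover consider "j = 0" | "j = 1" | "2 \<le> j" by linarith
    ultimately show ?thesis
      by cases (auto simp: E_def[abs_def])
  qed
  have "\<exists>y. (\<forall>i<n. y i \<in> S \<and> G k (y i) - E k (y i) = 0) \<and> (\<forall>i. Suc i < n \<longrightarrow> y i < y (Suc i))"
  proof (rule iterated_Rolle[OF S(2)])
    show "((\<lambda>x. G j x - E j x) has_real_derivative G (Suc j) x - E (Suc j) x) (at x)"
      if "x \<in> S" for j x
      by (intro DERIV_diff deriv E that)
    show "z i \<in> S \<and> G 0 (z i) - E 0 (z i) = 0" if "i < n + k" for i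
      using z[OF that] f by (auto simp: E_def)
  qed (use mono in auto)
  then obtain y where y: "\<And>i. i < n \<Longrightarrow> y i \<in> S \<and> G k (y i) = 0"
    and ymono: "\<And>i. Suc i < n \<Longrightarrow> y i < y (Suc i)"
    using \<open>2 \<le> k\<close> by (auto simp: E_def)
  have "i < j \<Longrightarrow> j < n \<Longrightarrow> y i < y j" for i j
  proof (induction j)
    case (Suc j)
    then show ?case using ymono[of j] by (cases "i = j") (auto intro: less_trans)
  qed simp
  then have "inj_on y {..<n}"
    by (intro linorder_inj_onI') (metis lessThan_iff less_irrefl)
  then have "finite (y ` {..<n})" "card (y ` {..<n}) = n"
    by (auto simp: card_image)
  moreover have "y ` {..<n} \<subseteq> deriv_zeros k f S"
    using y deriv_iterate_eq[OF S(1) deriv f] by (auto simp: deriv_zeros_def)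
  ultimately show ?thesis by blast
qed

section \<open>A class of functions closed under differentiation\<close>

text \<open>
  Contains all functions of the temperature parameter from which the dimension is assembled. The
  side conditions are imposed on the whole line, so that an elementary function is differentiable
  everywhere and no domain has to be carried along.
\<close>

inductive elementary :: "(real \<Rightarrow> real) \<Rightarrow> bool" where
  const: "elementary (\<lambda>x. c)"
| ident: "elementary (\<lambda>x. x)"
| expo: "elementary (\<lambda>x. exp (c * x))"
| add: "elementary f \<Longrightarrow> elementary g \<Longrightarrow> elementary (\<lambda>x. f x + g x)"
| mult: "elementary f \<Longrightarrow> elementary g \<Longrightarrow> elementary (\<lambda>x. f x * g x)"
| inv: "elementary f \<Longrightarrow> (\<And>x. f x \<noteq> 0) \<Longrightarrow> elementary (\<lambda>x. inverse (f x))"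
| log: "elementary f \<Longrightarrow> (\<And>x. f x > 0) \<Longrightarrow> elementary (\<lambda>x. ln (f x))"

lemma elementary_has_elementary_derivative:
  assumes "elementary f"
  shows "\<exists>f'. elementary f' \<and> (\<forall>x. (f has_real_derivative f' x) (at x))"
  using assms
proof (induction rule: elementary.induct)
  case (const c)
  then show ?case by (intro exI[of _ "\<lambda>x. 0"]) (auto intro: elementary.intros)
next
  case ident
  then show ?case by (intro exI[of _ "\<lambda>x. 1"]) (auto intro: elementary.intros)
next
  case (expo c)
  then show ?case
    by (intro exI[of _ "\<lambda>x. c * exp (c * x)"])
      (auto intro!: elementary.intros derivative_eq_intros)
next
  case (add f g)
  then obtain f' g' where "elementary f'" "elementary g'"
    "\<And>x. (f has_real_derivative f' x) (at x)" "\<And>x. (g has_real_derivative g' x) (at x)" by blast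
  then show ?case
    by (intro exI[of _ "\<lambda>x. f' x + g' x"]) (auto intro!: elementary.intros derivative_intros)
next
  case (mult f g)
  then obtain f' g' where "elementary f'" "elementary g'"
    "\<And>x. (f has_real_derivative f' x) (at x)" "\<And>x. (g has_real_derivative g' x) (at x)" by blast
  with mult show ?case
    by (intro exI[of _ "\<lambda>x. f' x * g x + g' x * f x"])
      (auto intro!: elementary.intros DERIV_mult)
next
  case (inv f)
  then obtain f' where "elementary f'" "\<And>x. (f has_real_derivative f' x) (at x)" by blast
  with inv show ?case
    by (intro exI[of _ "\<lambda>x. (-1) * (inverse (f x) * f' x * inverse (f x))"] conjI
        elementary.mult elementary.const elementary.inv) (auto intro!: DERIV_inverse' derivative_eq_intros)
next
  case (log f)
  then obtain f' where f': "elementary f'" "\<And>x. (f has_real_derivative f' x) (at x)" by blast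
  have "f x \<noteq> 0" for x using log(2)[of x] by simp
  with log f' show ?case
    by (intro exI[of _ "\<lambda>x. inverse (f x) * f' x"] conjI elementary.mult elementary.inv)
      (auto intro!: derivative_eq_intros simp: field_simps)
qed

lemma elementary_sum:
  assumes "\<And>i. i \<in> A \<Longrightarrow> elementary (f i)"
  shows "elementary (\<lambda>x. \<Sum>i\<in>A. f i x)"
  using assms
proof (induction A rule: infinite_finite_induct)
  case (insert i A)
  then show ?case using elementary.add[of "f i" "\<lambda>x. \<Sum>i\<in>A. f i x"] by auto
qed (auto intro: elementary.intros)

text \<open>
  Smoothness is transported through a change of variable: if \<open>\<sigma>' = 1 / (v \<circ> \<sigma>)\<close>, then all
  derivatives of \<open>F \<circ> \<sigma>\<close> are again of the form elementary function after \<open>\<sigma>\<close>.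
\<close>

lemma elementary_compose_smooth:
  assumes F: "elementary F" and v: "elementary v" "\<And>x. v x \<noteq> 0"
    and \<sigma>: "\<And>y. y \<in> S \<Longrightarrow> (\<sigma> has_real_derivative inverse (v (\<sigma> y))) (at y)"
  obtains G where "\<And>y. G 0 y = F (\<sigma> y)"
    and "\<And>j y. y \<in> S \<Longrightarrow> (G j has_real_derivative G (Suc j) y) (at y)"
proof -
  obtain D where D: "\<And>f. elementary f \<Longrightarrow> elementary (D f)"
      "\<And>f x. elementary f \<Longrightarrow> (f has_real_derivative D f x) (at x)"
    using elementary_has_elementary_derivative by metis
  define H where "H = rec_nat F (\<lambda>_ f x. D f x * inverse (v x))"
  have H0: "H 0 = F" and HS: "\<And>j. H (Suc j) = (\<lambda>x. D (H j) x * inverse (v x))"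
    by (auto simp: H_def)
  have H: "elementary (H j)" for j
    by (induction j) (auto simp: H0 HS intro!: elementary.intros F v D(1))
  show thesis
  proof (rule that[of "\<lambda>j y. H j (\<sigma> y)"])
    show "((\<lambda>y. H j (\<sigma> y)) has_real_derivative H (Suc j) (\<sigma> y)) (at y)" if "y \<in> S" for j y
      using DERIV_chain2[OF D(2)[OF H[of j], of "\<sigma> y"] \<sigma>[OF that]] by (simp add: HS)
  qed (simp add: H0)
qed

section \<open>Pressure and entropy\<close>

text \<open>
  The letters \<open>i \<in> I\<close> carry exponents \<open>a i\<close>, later the logarithmic slopes of the branches.
  Two of them must differ: otherwise the spectrum lives on a single point and the variance below
  vanishes.
\<close>

locale weights =
  fixes I :: "nat set" and a :: "nat \<Rightarrow> real"
  assumes finite_I: "finite I"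
    and a_pos: "i \<in> I \<Longrightarrow> 0 < a i"
    and a_nonconst: "\<exists>i\<in>I. \<exists>j\<in>I. a i < a j"
begin

definition partition_sum :: "real \<Rightarrow> real" where "partition_sum s = (\<Sum>i\<in>I. exp (- a i * s))"
definition pressure :: "real \<Rightarrow> real" where "pressure s = ln (partition_sum s)"
definition gibbs :: "real \<Rightarrow> nat \<Rightarrow> real" where "gibbs s i = exp (- a i * s) / partition_sum s"
definition mean :: "real \<Rightarrow> real" where "mean s = (\<Sum>i\<in>I. gibbs s i * a i)"
definition var :: "real \<Rightarrow> real" where "var s = (\<Sum>i\<in>I. gibbs s i * (a i - mean s)\<^sup>2)"
definition a_min :: real where "a_min = Min (a ` I)"
definition a_max :: real where "a_max = Max (a ` I)"

lemma I_nonempty: "I \<noteq> {}" using a_nonconst by auto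

lemma partition_sum_pos: "0 < partition_sum s"
  unfolding partition_sum_def by (rule sum_pos) (use I_nonempty finite_I in auto)

lemma gibbs_pos: "0 < gibbs s i"
  unfolding gibbs_def using partition_sum_pos by simp

lemma gibbs_sum: "(\<Sum>i\<in>I. gibbs s i) = 1"
  unfolding gibbs_def using partition_sum_pos[of s]
  by (simp add: partition_sum_def flip: sum_divide_distrib)

lemma gibbs_average_affine: "(\<Sum>i\<in>I. gibbs s i * (c + d * a i)) = c + d * mean s"
proof -
  have "(\<Sum>i\<in>I. gibbs s i * (c + d * a i)) = (\<Sum>i\<in>I. c * gibbs s i + d * (gibbs s i * a i))"
    by (intro sum.cong) (auto simp: algebra_simps)
  also have "\<dots> = c * (\<Sum>i\<in>I. gibbs s i) + d * mean s"
    unfolding mean_def by (simp add: sum.distrib sum_distrib_left)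
  finally show ?thesis by (simp add: gibbs_sum)
qed

lemma gibbs_eq: "gibbs s i = exp (- (a i * s) - pressure s)"
  by (simp add: gibbs_def pressure_def exp_diff partition_sum_pos)

lemma gibbs_le_1: assumes "i \<in> I" shows "gibbs s i \<le> 1"
  using member_le_sum[of i "I" "gibbs s"] assms gibbs_sum gibbs_pos
  by (auto simp: less_imp_le finite_I)

lemma a_bounds: assumes "i \<in> I" shows "a_min \<le> a i" "a i \<le> a_max"
  using assms finite_I by (auto simp: a_min_def a_max_def)

lemma a_min_attained: "\<exists>i\<in>I. a i = a_min"
proof -
  have "a_min \<in> a ` I" unfolding a_min_def using I_nonempty finite_I by (intro Min_in) auto
  then show ?thesis by auto
qed

lemma a_max_attained: "\<exists>i\<in>I. a i = a_max"
proof -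
  have "a_max \<in> a ` I" unfolding a_max_def using I_nonempty finite_I by (intro Max_in) auto
  then show ?thesis by auto
qed

lemma a_min_pos: "0 < a_min" using a_min_attained a_pos by fastforce

lemma a_min_less_max: "a_min < a_max"
  using a_nonconst a_bounds by force

lemma mean_pos: "0 < mean s"
  unfolding mean_def by (rule sum_pos) (use I_nonempty finite_I gibbs_pos a_pos in auto)

lemma var_pos: "0 < var s"
proof -
  obtain i where i: "i \<in> I" "a i \<noteq> mean s" using a_nonconst by (metis less_irrefl)
  have "0 < gibbs s i * (a i - mean s)\<^sup>2" using i gibbs_pos[of s i] by simp
  also have "\<dots> \<le> var s"
    unfolding var_def using i gibbs_pos
    by (intro member_le_sum) (auto simp: less_imp_le finite_I)
  finally show ?thesis .
qed

lemma DERIV_partition_sum: "(partition_sum has_real_derivative - (\<Sum>i\<in>I. a i * exp (- a i * s))) (at s)"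
  unfolding partition_sum_def
  by (auto intro!: derivative_eq_intros simp: sum_negf[symmetric] mult_ac)

lemma mean_eq: "mean s = (\<Sum>i\<in>I. a i * exp (- a i * s)) / partition_sum s"
  by (simp add: mean_def gibbs_def sum_divide_distrib mult_ac)

text \<open>
  The second moment form of the variance, needed both to differentiate the mean and to see that
  the variance is elementary.
\<close>

lemma var_eq: "var s = (\<Sum>i\<in>I. (a i)\<^sup>2 * exp (- a i * s)) / partition_sum s - (mean s)\<^sup>2"
proof -
  have "var s = (\<Sum>i\<in>I. gibbs s i * (a i)\<^sup>2 - 2 * mean s * (gibbs s i * a i) + (mean s)\<^sup>2 * gibbs s i)"
    unfolding var_def by (intro sum.cong) (auto simp: power2_eq_square algebra_simps)
  also have "\<dots> = (\<Sum>i\<in>I. gibbs s i * (a i)\<^sup>2) - (mean s)\<^sup>2"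
    using gibbs_sum[of s] mean_def[of s]
    by (simp add: sum.distrib sum_subtractf sum_distrib_left[symmetric] power2_eq_square)
  finally show ?thesis by (simp add: gibbs_def sum_divide_distrib mult_ac)
qed

lemma DERIV_mean: "(mean has_real_derivative - var s) (at s)"
proof -
  have "((\<lambda>s. \<Sum>i\<in>I. a i * exp (- a i * s)) has_real_derivative
      - (\<Sum>i\<in>I. (a i)\<^sup>2 * exp (- a i * s))) (at s)"
    by (auto intro!: derivative_eq_intros simp: sum_negf[symmetric] mult_ac power2_eq_square)
  from DERIV_divide[OF this DERIV_partition_sum[of s]] partition_sum_pos[of s]
  have "(mean has_real_derivative
      (- (\<Sum>i\<in>I. (a i)\<^sup>2 * exp (- a i * s)) * partition_sum s
        - (\<Sum>i\<in>I. a i * exp (- a i * s)) * (- (\<Sum>i\<in>I. a i * exp (- a i * s)))) / (partition_sum s * partition_sum s)) (at s)"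
    unfolding mean_eq[abs_def] by auto
  moreover have "(- B * partition_sum s - C * - C) / (partition_sum s * partition_sum s) = - (B / partition_sum s - (C / partition_sum s)\<^sup>2)" for B C
    using partition_sum_pos[of s] by (simp add: field_simps power2_eq_square)
  ultimately show ?thesis by (simp only: var_eq mean_eq)
qed

lemma elementary_pressure: "elementary pressure"
  unfolding pressure_def[abs_def] partition_sum_def
  by (intro elementary.log elementary_sum elementary.expo) (use partition_sum_pos in \<open>auto simp: partition_sum_def\<close>)

lemma elementary_mean: "elementary mean"
  unfolding mean_eq[abs_def] divide_inverse
proof (intro elementary.mult elementary.inv elementary_sum elementary.const elementary.expo)
  show "elementary partition_sum" unfolding partition_sum_def[abs_def] by (intro elementary_sum elementary.expo)
  show "partition_sum x \<noteq> 0" for x using partition_sum_pos[of x] by simp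
qed

lemma elementary_var: "elementary var"
proof -
  have "elementary partition_sum" unfolding partition_sum_def[abs_def] by (intro elementary_sum elementary.expo)
  moreover have "partition_sum x \<noteq> 0" for x using partition_sum_pos[of x] by simp
  moreover have "var s = (\<Sum>i\<in>I. (a i)\<^sup>2 * exp (- a i * s)) * inverse (partition_sum s)
      + (- 1) * (mean s * mean s)" for s
    by (simp add: var_eq power2_eq_square divide_inverse)
  ultimately show ?thesis
    by (subst ext[of var "\<lambda>s. (\<Sum>i\<in>I. (a i)\<^sup>2 * exp (- a i * s)) * inverse (partition_sum s)
      + (- 1) * (mean s * mean s)"])
      (assumption | intro elementary.intros elementary_sum elementary_mean)+
qed

lemma mean_strict_antimono: assumes "s < t" shows "mean t < mean s"
  by (rule DERIV_neg_imp_decreasing[OF assms]) (use DERIV_mean var_pos in fastforce)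

text \<open>
  If one of the exponents \<open>d i\<close> is positive, its term eventually dominates the negative ones,
  which stay bounded; this is why the Gibbs mean sweeps out the whole open range.
\<close>

lemma exp_sum_eventually_pos:
  fixes d :: "nat \<Rightarrow> real"
  assumes "finite A" "i \<in> A" "0 < d i"
  shows "\<exists>t. 0 < (\<Sum>j\<in>A. exp (t * d j) * d j)"
proof
  define C where "C = (\<Sum>j\<in>A. \<bar>d j\<bar>)"
  \<comment> \<open>With this \<open>t\<close> the lower bound \<open>(1 + t * d i) * d i\<close> of the positive term is \<open>d i + C\<close>.\<close>
  define t where "t = C / (d i)\<^sup>2"
  have C: "C \<ge> 0" by (auto simp: C_def intro: sum_nonneg)
  then have t: "t \<ge> 0" by (auto simp: t_def)
  have ge: "- \<bar>d j\<bar> \<le> exp (t * d j) * d j" for j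
  proof (cases "d j \<ge> 0")
    case False
    then have "exp (t * d j) \<le> 1" using t by (simp add: mult_nonneg_nonpos)
    then show ?thesis using False mult_right_mono_neg[of "exp (t * d j)" 1 "d j"] by auto
  next
    case True
    have "- \<bar>d j\<bar> \<le> 0" by simp
    also have "0 \<le> exp (t * d j) * d j" using True by simp
    finally show ?thesis .
  qed
  have "(1 + t * d i) * d i \<le> exp (t * d i) * d i"
    using assms by (intro mult_right_mono exp_ge_add_one_self) auto
  moreover have "(1 + t * d i) * d i = d i + C"
    using assms by (simp add: t_def power2_eq_square field_simps)
  ultimately have "C + d i \<le> exp (t * d i) * d i" by simp
  moreover have "(\<Sum>j\<in>A - {i}. - \<bar>d j\<bar>) \<le> (\<Sum>j\<in>A - {i}. exp (t * d j) * d j)"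
    by (intro sum_mono ge)
  moreover have "(\<Sum>j\<in>A - {i}. - \<bar>d j\<bar>) = - C + \<bar>d i\<bar>"
    using assms by (simp add: C_def sum_negf sum.remove)
  ultimately have "0 < exp (t * d i) * d i + (\<Sum>j\<in>A - {i}. exp (t * d j) * d j)"
    using assms by linarith
  also have "\<dots> = (\<Sum>j\<in>A. exp (t * d j) * d j)"
    using assms by (simp add: sum.remove)
  finally show "0 < (\<Sum>j\<in>A. exp (t * d j) * d j)" .
qed

lemma mean_compare:
  "mean s - \<alpha> = exp (- s * \<alpha>) / partition_sum s * (\<Sum>i\<in>I. exp (- s * (a i - \<alpha>)) * (a i - \<alpha>))"
proof -
  have "mean s - \<alpha> = (\<Sum>i\<in>I. gibbs s i * (a i - \<alpha>))"
    using gibbs_average_affine[of s "- \<alpha>" 1] by simp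
  also have "\<dots> = (\<Sum>i\<in>I. exp (- s * \<alpha>) / partition_sum s * (exp (- s * (a i - \<alpha>)) * (a i - \<alpha>)))"
  proof (intro sum.cong refl)
    fix i
    have "exp (- a i * s) = exp (- s * \<alpha>) * exp (- s * (a i - \<alpha>))"
      unfolding exp_add[symmetric] by (simp add: algebra_simps)
    then show "gibbs s i * (a i - \<alpha>) = exp (- s * \<alpha>) / partition_sum s * (exp (- s * (a i - \<alpha>)) * (a i - \<alpha>))"
      by (simp add: gibbs_def)
  qed
  finally show ?thesis by (simp add: sum_distrib_left)
qed

lemma mean_surj:
  assumes "\<alpha> \<in> {a_min<..<a_max}" shows "\<exists>s. mean s = \<alpha>"
proof -
  obtain i where i: "i \<in> I" "0 < a i - \<alpha>" using a_max_attained assms by auto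
  obtain t where t: "0 < (\<Sum>j\<in>I. exp (t * (a j - \<alpha>)) * (a j - \<alpha>))"
    using exp_sum_eventually_pos[OF finite_I, of i "\<lambda>j. a j - \<alpha>"] i by auto
  have "0 < mean (- t) - \<alpha>" unfolding mean_compare using t partition_sum_pos[of "- t"] by simp
  moreover
  obtain k where k: "k \<in> I" "0 < \<alpha> - a k" using a_min_attained assms by auto
  obtain u where u: "0 < (\<Sum>j\<in>I. exp (u * (\<alpha> - a j)) * (\<alpha> - a j))"
    using exp_sum_eventually_pos[OF finite_I, of k "\<lambda>j. \<alpha> - a j"] k by auto
  have "(\<Sum>j\<in>I. exp (- u * (a j - \<alpha>)) * (a j - \<alpha>)) = - (\<Sum>j\<in>I. exp (u * (\<alpha> - a j)) * (\<alpha> - a j))"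
    by (simp add: sum_negf[symmetric] algebra_simps)
  then have "mean u - \<alpha> < 0"
    unfolding mean_compare using u partition_sum_pos[of u] by (simp add: divide_less_0_iff mult_pos_neg)
  ultimately have *: "mean u < \<alpha>" "\<alpha> < mean (- t)" by auto
  then have "- t < u" using mean_strict_antimono[of u "- t"] by (cases u "- t" rule: linorder_cases) auto
  moreover have "\<And>x. isCont mean x" using DERIV_mean DERIV_isCont by blast
  ultimately show ?thesis using IVT2[of mean u \<alpha> "- t"] * by auto
qed

text \<open>
  The inverse function of \<open>mean\<close>. It selects the Gibbs weights whose Bernoulli measure is
  carried by the codes of exponent \<open>\<alpha>\<close>.
\<close>

definition temp :: "real \<Rightarrow> real" where "temp \<alpha> = (THE s. mean s = \<alpha>)"

lemma temp_mean: "temp (mean s) = s"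
  unfolding temp_def
proof (rule the_equality)
  show "t = s" if "mean t = mean s" for t
    using that mean_strict_antimono[of s t] mean_strict_antimono[of t s]
    by (cases s t rule: linorder_cases) auto
qed simp

lemma mean_temp: assumes "\<alpha> \<in> {a_min<..<a_max}" shows "mean (temp \<alpha>) = \<alpha>"
  using mean_surj[OF assms] temp_mean by auto

lemma DERIV_temp:
  assumes "\<alpha> \<in> {a_min<..<a_max}"
  shows "(temp has_real_derivative inverse (- var (temp \<alpha>))) (at \<alpha>)"
proof -
  have cont: "isCont mean x" for x using DERIV_mean DERIV_isCont by blast
  have "isCont temp (mean (temp \<alpha>))"
    by (rule isCont_inverse_function[of 1]) (auto simp: temp_mean cont)
  then have "isCont temp \<alpha>" using mean_temp[OF assms] by simp
  show ?thesis
    by (rule DERIV_inverse_function[where f=mean and a=a_min and b=a_max])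
      (use assms DERIV_mean var_pos[of "temp \<alpha>"] mean_temp \<open>isCont temp \<alpha>\<close> in auto)
qed

text \<open>
  The quotient of entropy and Lyapunov exponent: with Gibbs weights \<open>p i = exp (- s * a i - P)\<close>
  of mean \<open>\<alpha>\<close> and pressure \<open>P\<close>, the entropy \<open>- (\<Sum>i\<in>I. p i * ln (p i))\<close> equals \<open>s * \<alpha> + P\<close>.
\<close>

definition dim_formula :: "real \<Rightarrow> real" where
  "dim_formula \<alpha> = temp \<alpha> + pressure (temp \<alpha>) / \<alpha>"

text \<open>
  The entropy is an average of the numbers \<open>- ln (p i) = s * a i + P\<close>, which are nonnegative because
  no weight exceeds \<open>1\<close>.
\<close>

lemma dim_formula_nonneg:
  assumes "\<alpha> \<in> {a_min<..<a_max}" shows "0 \<le> dim_formula \<alpha>"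
proof -
  let ?s = "temp \<alpha>"
  have "0 \<le> (\<Sum>i\<in>I. gibbs ?s i * (a i * ?s + pressure ?s))"
  proof (intro sum_nonneg mult_nonneg_nonneg)
    fix i assume "i \<in> I"
    from gibbs_le_1[OF this, of ?s] show "0 \<le> a i * ?s + pressure ?s" by (simp add: gibbs_eq)
  qed (use gibbs_pos less_imp_le in auto)
  also have "\<dots> = mean ?s * ?s + pressure ?s"
    using gibbs_average_affine[of ?s "pressure ?s" ?s] by (simp add: algebra_simps)
  finally have "0 \<le> \<alpha> * ?s + pressure ?s" using mean_temp[OF assms] by simp
  moreover have "0 < \<alpha>" using assms a_min_pos by simp
  ultimately have "0 \<le> (\<alpha> * ?s + pressure ?s) / \<alpha>" by simp
  then show ?thesis using \<open>0 < \<alpha>\<close> by (simp add: dim_formula_def add_divide_distrib)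
qed

text \<open>
  The pressure lies above its tangents, so the entropy \<open>\<alpha> * dim_formula \<alpha>\<close> is the minimum over
  all \<open>s\<close> of \<open>pressure s + s * \<alpha>\<close>. The proof is \<open>1 + x \<le> exp x\<close> averaged over the Gibbs weights.
\<close>

lemma dim_formula_le:
  assumes "\<alpha> \<in> {a_min<..<a_max}"
  shows "\<alpha> * dim_formula \<alpha> \<le> pressure s + s * \<alpha>"
proof -
  define t where "t = temp \<alpha>"
  have t: "mean t = \<alpha>" using mean_temp[OF assms] by (simp add: t_def)
  have "1 = (\<Sum>i\<in>I. gibbs t i * (1 + - (s - t) * (a i - \<alpha>)))"
    using gibbs_average_affine[of t "1 + (s - t) * \<alpha>" "- (s - t)"] t by (simp add: algebra_simps)
  also have "\<dots> \<le> (\<Sum>i\<in>I. gibbs t i * exp (- (s - t) * (a i - \<alpha>)))"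
    by (intro sum_mono mult_left_mono exp_ge_add_one_self) (use gibbs_pos less_imp_le in auto)
  also have "\<dots> = (\<Sum>i\<in>I. exp (- a i * s) * exp ((s - t) * \<alpha> - pressure t))"
    unfolding gibbs_eq exp_add[symmetric] by (simp add: algebra_simps)
  also have "\<dots> = exp (pressure s + (s - t) * \<alpha> - pressure t)"
    using partition_sum_pos[of s]
    unfolding sum_distrib_right[symmetric] partition_sum_def[symmetric]
    by (simp add: pressure_def flip: exp_add)
      (simp add: exp_add exp_diff)
  finally have "0 \<le> pressure s + (s - t) * \<alpha> - pressure t" by simp
  moreover have "\<alpha> * dim_formula \<alpha> = t * \<alpha> + pressure t"
    using assms a_min_pos by (simp add: dim_formula_def t_def field_simps)
  ultimately show ?thesis by (simp add: algebra_simps)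
qed

lemma dim_formula_ge:
  assumes "\<alpha> \<in> {a_min<..<a_max}" and "\<And>s. c \<le> pressure s + s * \<alpha>"
  shows "c \<le> \<alpha> * dim_formula \<alpha>"
proof -
  have "\<alpha> * dim_formula \<alpha> = pressure (temp \<alpha>) + temp \<alpha> * \<alpha>"
    using assms(1) a_min_pos by (simp add: dim_formula_def field_simps)
  then show ?thesis using assms(2) by simp
qed

text \<open>
  In the parameter \<open>s = temp \<alpha>\<close> the dimension is \<open>s + pressure s / mean s\<close>, an elementary function,
  and the derivative of \<open>temp\<close> is minus the reciprocal of the variance.
\<close>

lemma dim_formula_smooth:
  obtains G where "\<And>\<alpha>. \<alpha> \<in> {a_min<..<a_max} \<Longrightarrow> G 0 \<alpha> = dim_formula \<alpha>"
    and "\<And>j \<alpha>. \<alpha> \<in> {a_min<..<a_max} \<Longrightarrow> (G j has_real_derivative G (Suc j) \<alpha>) (at \<alpha>)"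
proof -
  have "elementary (\<lambda>s. s + pressure s * inverse (mean s))"
    by (intro elementary.intros elementary_pressure elementary_mean) (use mean_pos in \<open>simp add: less_imp_neq[symmetric]\<close>)
  moreover have "elementary (\<lambda>s. - 1 * var s)"
    by (intro elementary.intros elementary_var)
  moreover have "- 1 * var s \<noteq> 0" for s using var_pos[of s] by simp
  moreover have "(temp has_real_derivative inverse (- 1 * var (temp \<alpha>))) (at \<alpha>)"
    if "\<alpha> \<in> {a_min<..<a_max}" for \<alpha>
    using DERIV_temp[OF that] by simp
  ultimately obtain G where "\<And>\<alpha>. G 0 \<alpha> = temp \<alpha> + pressure (temp \<alpha>) * inverse (mean (temp \<alpha>))"
    "\<And>j \<alpha>. \<alpha> \<in> {a_min<..<a_max} \<Longrightarrow> (G j has_real_derivative G (Suc j) \<alpha>) (at \<alpha>)"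
    using elementary_compose_smooth by blast
  then show thesis
    using mean_temp by (intro that[of G]) (auto simp: dim_formula_def divide_inverse)
qed

end

section \<open>A piecewise linear map with prescribed branch lengths\<close>

locale branch_lengths =
  fixes q :: nat and r :: "nat \<Rightarrow> real"
  assumes two_le_q: "2 \<le> q"
    and r_pos': "i \<in> {1..q} \<Longrightarrow> 0 < r i"
    and r_sum': "(\<Sum>i\<in>{1..q}. r i) < 1"
begin

definition I :: "nat set" where "I = {1..q}"
definition gap :: real where "gap = (1 - (\<Sum>i\<in>I. r i)) / q"
definition left_end :: "nat \<Rightarrow> real" where "left_end i = (\<Sum>j\<in>{1..<i}. r j + gap)"
definition X :: "nat \<Rightarrow> real set" where "X i = {left_end i..left_end i + r i}"
definition code :: "real \<Rightarrow> nat" where "code x = (THE i. i \<in> I \<and> x \<in> X i)"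
definition T :: "real \<Rightarrow> real" where "T x = (x - left_end (code x)) / r (code x)"
definition itinerary :: "real \<Rightarrow> nat \<Rightarrow> nat" where "itinerary x j = code ((T ^^ j) x)"
definition R :: "(nat \<Rightarrow> nat) \<Rightarrow> nat \<Rightarrow> real" where "R \<omega> n = (\<Prod>j<n. r (\<omega> j))"
definition inv_set :: "real set" where "inv_set = invariant_set q X T"

lemma finite_I: "finite I" by (simp add: I_def)
lemma r_pos: "i \<in> I \<Longrightarrow> 0 < r i" using r_pos' by (simp add: I_def)
lemma r_sum: "(\<Sum>i\<in>I. r i) < 1" using r_sum' by (simp add: I_def)

lemma r_less_1: assumes "i \<in> I" shows "r i < 1"
  using member_le_sum[of i I r] assms r_pos r_sum finite_I by (force simp: less_imp_le)

lemma gap_pos: "0 < gap" using r_sum two_le_q by (simp add: gap_def)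

lemma left_end_Suc: "1 \<le> i \<Longrightarrow> left_end (Suc i) = left_end i + r i + gap"
  by (simp add: left_end_def atLeastLessThanSuc)

lemma left_end_mono:
  assumes "1 \<le> i" "i \<le> j" "j \<le> Suc q" shows "left_end i \<le> left_end j"
  unfolding left_end_def
proof (rule sum_mono2)
  show "0 \<le> r k + gap" if "k \<in> {1..<j} - {1..<i}" for k
    using r_pos[of k] gap_pos that assms by (simp add: I_def)
qed (use assms in auto)

text \<open>
  Every branch is followed by a gap. The separation of distinct branches by at least
  \<open>gap\<close> is the source of the lower bound for the dimension.
\<close>

lemma left_end_step:
  assumes "i \<in> I" "j \<in> I" "i < j" shows "left_end i + r i + gap \<le> left_end j"
  using left_end_mono[of "Suc i" j] left_end_Suc[of i] assms by (auto simp: I_def)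

lemma left_end_nonneg: "i \<in> I \<Longrightarrow> 0 \<le> left_end i"
  using left_end_mono[of 1 i] by (simp add: I_def left_end_def)

lemma left_end_le: assumes "i \<in> I" shows "left_end i + r i \<le> 1"
proof -
  \<comment> \<open>\<open>Suc q\<close> marks the right end of the gap after the last branch, which is the point \<open>1\<close>.\<close>
  have "left_end (Suc q) = (\<Sum>j\<in>I. r j) + q * gap"
    unfolding left_end_def I_def by (simp add: sum.distrib atLeastLessThanSuc_atLeastAtMost)
  also have "\<dots> = 1" using two_le_q by (simp add: gap_def)
  finally show ?thesis
    using left_end_mono[of "Suc i" "Suc q"] left_end_Suc[of i] gap_pos assms by (auto simp: I_def)
qed

lemma X_sub: "i \<in> I \<Longrightarrow> X i \<subseteq> {0..1}"
  using left_end_nonneg[of i] left_end_le[of i] by (auto simp: X_def)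

lemma X_gap:
  assumes "i \<in> I" "j \<in> I" "x \<in> X i" "y \<in> X j" "\<bar>x - y\<bar> < gap" shows "i = j"
  using left_end_step[of i j] left_end_step[of j i] assms
  by (cases i j rule: linorder_cases) (auto simp: X_def)

lemma code_eq: assumes "i \<in> I" "x \<in> X i" shows "code x = i"
  unfolding code_def
proof (rule the_equality)
  show "j = i" if "j \<in> I \<and> x \<in> X j" for j
    using X_gap[of j i x x] gap_pos assms that by simp
qed (use assms in simp)

lemma T_eq: assumes "i \<in> I" "x \<in> X i" shows "T x = (x - left_end i) / r i"
  using code_eq[OF assms] by (simp add: T_def)

lemma T_branch: assumes "i \<in> I" "y \<in> {0..1}"
  shows "left_end i + r i * y \<in> X i" "T (left_end i + r i * y) = y"
proof -
  show *: "left_end i + r i * y \<in> X i"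
    using assms r_pos[of i] mult_left_mono[of y 1 "r i"] by (auto simp: X_def)
  show "T (left_end i + r i * y) = y" using T_eq[OF assms(1) *] r_pos[of i] assms by simp
qed

lemma T_inverse: assumes "i \<in> I" "x \<in> X i"
  shows "T x \<in> {0..1}" "left_end i + r i * T x = x"
proof -
  have "r i * T x = x - left_end i" using T_eq[OF assms] r_pos[OF assms(1)] by simp
  then show "left_end i + r i * T x = x" by simp
  show "T x \<in> {0..1}"
    using T_eq[OF assms] r_pos[OF assms(1)] assms(2) by (simp add: X_def)
qed

theorem piecewise_linear: "piecewise_linear_map q X T"
  unfolding piecewise_linear_map_def I_def[symmetric]
proof (intro conjI ballI)
  fix i assume i: "i \<in> I"
  show "\<exists>a b. 0 \<le> a \<and> a < b \<and> b \<le> 1 \<and> X i = {a..b}"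
    using left_end_nonneg[OF i] left_end_le[OF i] r_pos[OF i] by (auto simp: X_def)
  have "T x = (1 / r i) * x + (- left_end i / r i)" if "x \<in> X i" for x
    using T_eq[OF i that] by (simp add: diff_divide_distrib)
  then show "\<exists>c d. \<forall>x\<in>X i. T x = c * x + d" by blast
  have "continuous_on (X i) (\<lambda>x. (x - left_end i) / r i)"
    by (intro continuous_intros) (use r_pos[OF i] in auto)
  then have "continuous_on (X i) T"
    using T_eq[OF i] by (simp cong: continuous_on_cong)
  moreover have "T ` X i = {0..1}"
  proof
    show "T ` X i \<subseteq> {0..1}" using T_inverse(1)[OF i] by auto
    show "{0..1} \<subseteq> T ` X i"
    proof
      fix y :: real assume "y \<in> {0..1}"
      from T_branch[OF i this] show "y \<in> T ` X i" by (metis imageI)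
    qed
  qed
  moreover have "(\<lambda>y. left_end i + r i * y) ` {0..1} = X i"
  proof
    show "(\<lambda>y. left_end i + r i * y) ` {0..1} \<subseteq> X i" using T_branch(1)[OF i] by auto
    show "X i \<subseteq> (\<lambda>y. left_end i + r i * y) ` {0..1}"
    proof
      fix x assume "x \<in> X i"
      from T_inverse[OF i this] show "x \<in> (\<lambda>y. left_end i + r i * y) ` {0..1}" by (metis imageI)
    qed
  qed
  ultimately have "homeomorphism (X i) {0..1} T (\<lambda>y. left_end i + r i * y)"
    unfolding homeomorphism_def using T_inverse(2)[OF i] T_branch(2)[OF i]
    by (auto intro!: continuous_intros)
  then show "\<exists>g. homeomorphism (X i) {0..1} T g" by blast
next
  show "disjoint_family_on X I"
    unfolding disjoint_family_on_def using X_gap gap_pos by fastforce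
qed (rule two_le_q)

subsection \<open>Itineraries\<close>

lemma inv_setD: assumes "x \<in> inv_set"
  shows "itinerary x j \<in> I" "(T ^^ j) x \<in> X (itinerary x j)" "(T ^^ j) x \<in> {0..1}"
proof -
  obtain i where i: "i \<in> I" "(T ^^ j) x \<in> X i"
    using assms unfolding inv_set_def invariant_set_def I_def[symmetric] by blast
  with code_eq[OF i] X_sub[OF i(1)]
  show "itinerary x j \<in> I" "(T ^^ j) x \<in> X (itinerary x j)" "(T ^^ j) x \<in> {0..1}" by (auto simp: itinerary_def)
qed

lemma R_0 [simp]: "R \<omega> 0 = 1" and R_Suc: "R \<omega> (Suc n) = R \<omega> n * r (\<omega> n)"
  by (simp_all add: R_def)

lemma R_Suc_shift: "R \<omega> (Suc n) = r (\<omega> 0) * R (\<lambda>j. \<omega> (Suc j)) n"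
  unfolding R_def by (rule prod.lessThan_Suc_shift)

lemma R_pos: "(\<And>j. \<omega> j \<in> I) \<Longrightarrow> 0 < R \<omega> n"
  unfolding R_def by (rule prod_pos) (use r_pos in auto)

lemma R_cong: "(\<And>j. j < n \<Longrightarrow> \<omega> j = \<eta> j) \<Longrightarrow> R \<omega> n = R \<eta> n"
  by (simp add: R_def)

lemma dist_same_itinerary:
  assumes "x \<in> inv_set" "y \<in> inv_set" and "\<And>j. j < n \<Longrightarrow> itinerary x j = itinerary y j"
  shows "\<bar>x - y\<bar> = R (itinerary x) n * \<bar>(T ^^ n) x - (T ^^ n) y\<bar>"
  using assms(3)
proof (induction n)
  case (Suc n)
  let ?u = "(T ^^ n) x" and ?v = "(T ^^ n) y" and ?i = "itinerary x n"
  have i: "?i \<in> I" "?u \<in> X ?i" "?v \<in> X ?i"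
    using inv_setD(1,2)[OF assms(1), of n] inv_setD(2)[OF assms(2), of n] Suc.prems[of n] by auto
  have "?u - ?v = r ?i * (T ?u - T ?v)"
    using T_inverse(2)[OF i(1,2)] T_inverse(2)[OF i(1,3)] by (simp add: algebra_simps)
  then have "\<bar>?u - ?v\<bar> = r ?i * \<bar>T ?u - T ?v\<bar>" using r_pos[OF i(1)] by (simp add: abs_mult)
  then show ?case using Suc by (simp add: R_Suc)
qed auto

lemma dist_le_R:
  assumes "x \<in> inv_set" "y \<in> inv_set" and "\<And>j. j < n \<Longrightarrow> itinerary x j = itinerary y j"
  shows "\<bar>x - y\<bar> \<le> R (itinerary x) n"
proof -
  have "\<bar>(T ^^ n) x - (T ^^ n) y\<bar> \<le> 1" using inv_setD(3)[OF assms(1), of n] inv_setD(3)[OF assms(2), of n] by auto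
  then show ?thesis
    using dist_same_itinerary[OF assms] R_pos[of "itinerary x" n] inv_setD(1)[OF assms(1)]
    by (simp add: mult_left_le)
qed

text \<open>Points whose itineraries first differ at time \<open>n\<close> are separated by a gap of generation \<open>n\<close>.\<close>

lemma same_itinerary_if_close:
  assumes x: "x \<in> inv_set" and y: "y \<in> inv_set"
    and close: "\<And>j. j < n \<Longrightarrow> \<bar>x - y\<bar> < gap * R (itinerary x) j"
  shows "j < n \<Longrightarrow> itinerary x j = itinerary y j"
proof (induction j rule: less_induct)
  case (less j)
  have R: "0 < R (itinerary x) j" using R_pos inv_setD(1)[OF x] by blast
  have "R (itinerary x) j * \<bar>(T ^^ j) x - (T ^^ j) y\<bar> < R (itinerary x) j * gap"
    using dist_same_itinerary[OF x y, of j] less close[of j] by (simp add: mult.commute)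
  then have "\<bar>(T ^^ j) x - (T ^^ j) y\<bar> < gap" using R by simp
  then show ?case using X_gap inv_setD(1,2)[OF x] inv_setD(1,2)[OF y] by blast
qed

text \<open>
  The point coded by \<open>\<omega>\<close>: the limit of the compositions of the inverse branches
  \<open>y \<mapsto> left_end i + r i * y\<close> along \<open>\<omega>\<close>, written as a series.
\<close>

definition pt :: "(nat \<Rightarrow> nat) \<Rightarrow> real" where "pt \<omega> = (\<Sum>j. left_end (\<omega> j) * R \<omega> j)"

text \<open>
  The prefix of length \<open>n\<close> sends the unit interval onto an interval of length \<open>R \<omega> n\<close> that begins
  at the partial sum; this interval stays inside the unit interval.
\<close>

lemma pt_partial:
  assumes "\<And>j. \<omega> j \<in> I" shows "(\<Sum>j<n. left_end (\<omega> j) * R \<omega> j) + R \<omega> n \<le> 1"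
proof (induction n)
  case (Suc n)
  have "R \<omega> n * (left_end (\<omega> n) + r (\<omega> n)) \<le> R \<omega> n"
    using left_end_le[OF assms] R_pos[of \<omega> n, OF assms] by (simp add: mult_left_le)
  with Suc show ?case by (simp add: R_Suc algebra_simps)
qed simp

lemma pt_in_unit:
  assumes "\<And>j. \<omega> j \<in> I"
  shows "summable (\<lambda>j. left_end (\<omega> j) * R \<omega> j)" "pt \<omega> \<in> {0..1}"
proof -
  have nonneg: "0 \<le> left_end (\<omega> j) * R \<omega> j" for j
    using left_end_nonneg[OF assms] R_pos[of \<omega>, OF assms] by (simp add: less_imp_le)
  have le: "(\<Sum>j<n. left_end (\<omega> j) * R \<omega> j) \<le> 1" for n
    using pt_partial[of \<omega> n, OF assms] R_pos[of \<omega> n, OF assms] by simp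
  show s: "summable (\<lambda>j. left_end (\<omega> j) * R \<omega> j)"
    by (rule summableI_nonneg_bounded[OF nonneg le])
  show "pt \<omega> \<in> {0..1}"
    using suminf_le_const[OF s le] suminf_nonneg[OF s nonneg] by (simp add: pt_def)
qed

lemma pt_shift:
  assumes "\<And>j. \<omega> j \<in> I"
  shows "pt \<omega> = left_end (\<omega> 0) + r (\<omega> 0) * pt (\<lambda>j. \<omega> (Suc j))"
proof -
  have "pt \<omega> = (\<Sum>j. left_end (\<omega> (Suc j)) * R \<omega> (Suc j)) + left_end (\<omega> 0)"
    unfolding pt_def using suminf_split_head[OF pt_in_unit(1)[of \<omega>, OF assms]] by simp
  also have "(\<Sum>j. left_end (\<omega> (Suc j)) * R \<omega> (Suc j)) = r (\<omega> 0) * pt (\<lambda>j. \<omega> (Suc j))"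
    using suminf_mult[OF pt_in_unit(1)[of "\<lambda>j. \<omega> (Suc j)"], of "r (\<omega> 0)"] assms
    by (simp add: pt_def R_Suc_shift mult_ac)
  finally show ?thesis by simp
qed

lemma pt_iterate:
  assumes "\<And>j. \<omega> j \<in> I"
  shows "(T ^^ n) (pt \<omega>) = pt (\<lambda>j. \<omega> (j + n))"
proof (induction n)
  case (Suc n)
  have "T (pt (\<lambda>j. \<omega> (j + n))) = pt (\<lambda>j. \<omega> (Suc (j + n)))"
    using pt_shift[of "\<lambda>j. \<omega> (j + n)"] T_branch(2)[of "\<omega> n" "pt (\<lambda>j. \<omega> (Suc (j + n)))"]
      pt_in_unit(2)[of "\<lambda>j. \<omega> (Suc (j + n))"] assms by simp
  with Suc show ?case by simp
qed simp

lemma pt_in_X: assumes "\<And>j. \<omega> j \<in> I" shows "pt \<omega> \<in> X (\<omega> 0)"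
  using pt_shift[of \<omega>, OF assms] T_branch(1)[of "\<omega> 0" "pt (\<lambda>j. \<omega> (Suc j))"]
    pt_in_unit(2)[of "\<lambda>j. \<omega> (Suc j)"] assms by simp

lemma pt_itinerary:
  assumes "\<And>j. \<omega> j \<in> I" shows "pt \<omega> \<in> inv_set" "itinerary (pt \<omega>) = \<omega>"
proof -
  have *: "(T ^^ n) (pt \<omega>) \<in> X (\<omega> n)" for n
    using pt_in_X[of "\<lambda>j. \<omega> (j + n)"] assms pt_iterate[of \<omega>, OF assms] by simp
  show "pt \<omega> \<in> inv_set"
    using * assms pt_in_unit(2)[of \<omega>, OF assms]
    unfolding inv_set_def invariant_set_def I_def[symmetric] by auto
  show "itinerary (pt \<omega>) = \<omega>"
    using code_eq[OF assms *] by (auto simp: itinerary_def)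
qed

subsection \<open>Derivatives of iterates\<close>

abbreviation dom :: "nat \<Rightarrow> real set" where "dom \<equiv> iterate_domain q X T"

lemma dom_eq: "dom n = {x \<in> {0..1}. \<forall>m<n. (T ^^ m) x \<in> (\<Union>i\<in>I. X i)}"
  by (simp add: iterate_domain_def I_def)

text \<open>
  Derivatives relative to the domain of an iterate are unique only because the domain has no
  isolated points. The affine inverse branches carry this property from one generation to the
  next.
\<close>

lemma dom_islimpt: "x \<in> dom n \<Longrightarrow> x islimpt dom n"
proof (induction n arbitrary: x)
  case 0
  moreover have "dom 0 = {0..1}" by (auto simp: dom_eq)
  ultimately show ?case by simp
next
  case (Suc n)
  then have "(T ^^ 0) x \<in> (\<Union>i\<in>I. X i)" unfolding dom_eq by blast
  then obtain i where i: "i \<in> I" "x \<in> X i" by auto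
  have "T x \<in> dom n"
    unfolding dom_eq
  proof (intro CollectI conjI allI impI)
    show "T x \<in> {0..1}" by (rule T_inverse(1)[OF i])
    show "(T ^^ m) (T x) \<in> (\<Union>i\<in>I. X i)" if "m < n" for m
    proof -
      have "(T ^^ Suc m) x \<in> (\<Union>i\<in>I. X i)"
        using Suc.prems that unfolding dom_eq by blast
      then show ?thesis by (simp only: funpow_Suc_right o_apply)
    qed
  qed
  from Suc.IH[OF this] have lim: "T x islimpt dom n" .
  show ?case
    unfolding islimpt_approachable
  proof (intro allI impI)
    fix e :: real assume "0 < e"
    then obtain y where y: "y \<in> dom n" "y \<noteq> T x" "dist y (T x) < e"
      using lim unfolding islimpt_approachable by blast
    define z where "z = left_end i + r i * y"
    have y01: "y \<in> {0..1}" using y by (simp add: dom_eq)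
    have z: "z \<in> X i" "T z = y" using T_branch[OF i(1) y01] by (auto simp: z_def)
    have "(T ^^ m) z \<in> (\<Union>i\<in>I. X i)" if "m < Suc n" for m
    proof (cases m)
      case 0
      then show ?thesis using z i by auto
    next
      case (Suc k)
      then have "(T ^^ m) z = (T ^^ k) y" by (simp only: funpow_Suc_right o_apply z)
      then show ?thesis using y(1) that Suc by (auto simp: dom_eq)
    qed
    then have "z \<in> dom (Suc n)" using z X_sub[OF i(1)] by (auto simp: dom_eq)
    moreover have "z \<noteq> x" using z y by auto
    moreover have "dist z x < e"
    proof -
      have "z - x = r i * (y - T x)" using T_inverse(2)[OF i] by (simp add: z_def algebra_simps)
      then have "\<bar>z - x\<bar> \<le> \<bar>y - T x\<bar>"
        using r_pos[OF i(1)] r_less_1[OF i(1)] by (simp add: abs_mult mult_left_le_one_le)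
      then show ?thesis using y by (simp add: dist_real_def)
    qed
    ultimately show "\<exists>x'\<in>dom (Suc n). x' \<noteq> x \<and> dist x' x < e" by blast
  qed
qed

lemma T_has_derivative:
  assumes "i \<in> I" "x \<in> X i"
  shows "(T has_real_derivative 1 / r i) (at x within (\<Union>i\<in>I. X i))"
proof (rule has_field_derivative_transform_within[OF _ gap_pos])
  show "((\<lambda>y. (y - left_end i) / r i) has_real_derivative 1 / r i) (at x within (\<Union>i\<in>I. X i))"
    using r_pos[OF assms(1)] by (auto intro!: derivative_eq_intros)
  show "(y - left_end i) / r i = T y" if y: "y \<in> (\<Union>i\<in>I. X i)" "dist y x < gap" for y
  proof -
    obtain j where j: "j \<in> I" "y \<in> X j" using y by auto
    then have "j = i" using X_gap[of j i y x] assms y by (auto simp: dist_real_def)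
    then show ?thesis using T_eq[OF j] by simp
  qed
qed (use assms in auto)

lemma iterate_has_derivative:
  assumes x: "x \<in> inv_set"
  shows "((T ^^ n) has_real_derivative 1 / R (itinerary x) n) (at x within dom n)"
proof (induction n)
  case 0
  then show ?case by (simp add: id_def)
next
  case (Suc n)
  have "(T has_real_derivative 1 / r (itinerary x n)) (at ((T ^^ n) x) within (T ^^ n) ` dom (Suc n))"
    by (rule DERIV_subset[OF T_has_derivative]) (use inv_setD[OF x] in \<open>auto simp: dom_eq\<close>)
  moreover have "((T ^^ n) has_real_derivative 1 / R (itinerary x) n) (at x within dom (Suc n))"
    by (rule DERIV_subset[OF Suc]) (auto simp: dom_eq)
  ultimately have "(T \<circ> T ^^ n has_real_derivative 1 / r (itinerary x n) * (1 / R (itinerary x) n)) (at x within dom (Suc n))"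
    by (rule DERIV_image_chain)
  then show ?case by (simp add: R_Suc mult.commute o_def)
qed

lemma iterate_deriv_eq:
  assumes x: "x \<in> inv_set" shows "iterate_deriv q X T n x = 1 / R (itinerary x) n"
  unfolding iterate_deriv_def
proof (rule vector_derivative_within)
  have "x \<in> dom n"
    using x unfolding inv_set_def invariant_set_def dom_eq I_def by blast
  from dom_islimpt[OF this] show "at x within dom n \<noteq> bot" by (simp add: trivial_limit_within)
  show "(T ^^ n has_vector_derivative 1 / R (itinerary x) n) (at x within dom n)"
    using iterate_has_derivative[OF x] by (simp add: has_real_derivative_iff_has_vector_derivative)
qed

definition a :: "nat \<Rightarrow> real" where "a i = - ln (r i)"
definition S :: "(nat \<Rightarrow> nat) \<Rightarrow> nat \<Rightarrow> real" where "S \<omega> n = (\<Sum>j<n. a (\<omega> j))"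

lemma R_eq_exp: assumes "\<And>j. j < n \<Longrightarrow> \<omega> j \<in> I" shows "R \<omega> n = exp (- S \<omega> n)"
  unfolding R_def S_def a_def using r_pos[OF assms] by (simp add: sum_negf exp_sum)

lemma lyapunov_iff:
  assumes x: "x \<in> inv_set"
  shows "has_lyapunov_exponent q X T x \<alpha> \<longleftrightarrow> (\<lambda>n. S (itinerary x) n / n) \<longlonglongrightarrow> \<alpha>"
proof -
  have "1 / real n * ln \<bar>iterate_deriv q X T n x\<bar> = S (itinerary x) n / n" for n
    using R_eq_exp[of n "itinerary x", OF inv_setD(1)[OF x]] R_pos[of "itinerary x" n, OF inv_setD(1)[OF x]]
    by (simp add: iterate_deriv_eq[OF x] ln_div)
  then show ?thesis unfolding has_lyapunov_exponent_def by (simp only:)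
qed

definition level :: "real \<Rightarrow> real set" where
  "level \<alpha> = {x \<in> inv_set. (\<lambda>n. S (itinerary x) n / n) \<longlonglongrightarrow> \<alpha>}"

lemma level_eq: "level \<alpha> = {x \<in> invariant_set q X T. has_lyapunov_exponent q X T x \<alpha>}"
  using lyapunov_iff by (auto simp: level_def inv_set_def)

end

locale nonuniform_lengths = branch_lengths +
  assumes nonuniform: "\<exists>i\<in>{1..q}. \<exists>j\<in>{1..q}. r i < r j"
begin

sublocale weights I a
proof
  show "0 < a i" if "i \<in> I" for i
    using r_pos[OF that] r_less_1[OF that] by (simp add: a_def)
  obtain i j where "i \<in> I" "j \<in> I" "r i < r j" using nonuniform by (auto simp: I_def)
  moreover from this have "a j < a i" using r_pos by (simp add: a_def)
  ultimately show "\<exists>i\<in>I. \<exists>j\<in>I. a i < a j" by blast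
qed (rule finite_I)

lemma S_bounds: assumes "\<And>j. \<omega> j \<in> I" shows "n * a_min \<le> S \<omega> n" "S \<omega> n \<le> n * a_max"
  using sum_bounded_below[of "{..<n}" a_min "\<lambda>j. a (\<omega> j)"]
    sum_bounded_above[of "{..<n}" "\<lambda>j. a (\<omega> j)" a_max] a_bounds assms
  by (auto simp: S_def)

lemma level_exponent_bounds:
  assumes "x \<in> level \<alpha>" shows "\<alpha> \<in> {a_min..a_max}"
proof -
  have x: "x \<in> inv_set" and lim: "(\<lambda>n. S (itinerary x) n / n) \<longlonglongrightarrow> \<alpha>" using assms by (auto simp: level_def)
  have "n * a_min \<le> S (itinerary x) n" "S (itinerary x) n \<le> n * a_max" for n
    using S_bounds[of "itinerary x" n, OF inv_setD(1)[OF x]] by auto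
  then have *: "S (itinerary x) n / n \<in> {a_min..a_max}" if "n \<ge> 1" for n
    using that by (simp add: field_simps)
  show ?thesis
    by (rule Lim_in_closed_set[OF _ _ _ lim]) (use * in \<open>auto intro!: eventually_sequentiallyI[of 1]\<close>)
qed

end

section \<open>The upper bound for the dimension\<close>

text \<open>
  An injective enumeration of the index set turns the cover into a sequence; the unused positions
  are filled with empty sets, which cost nothing.
\<close>

lemma hausdorff_premeasure_le_countable_cover:
  fixes U :: "'k \<Rightarrow> 'a::metric_space set"
  assumes K: "countable K" and cover: "E \<subseteq> (\<Union>k\<in>K. U k)" and "0 \<le> \<delta>"
    and small: "\<And>k. k \<in> K \<Longrightarrow> bounded (U k) \<and> diameter (U k) \<le> \<delta>"
  shows "hausdorff_premeasure s \<delta> E \<le> (\<integral>\<^sup>+k. diam_pow s (U k) \<partial>count_space K)"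
proof -
  let ?h = "to_nat_on K"
  have bij: "bij_betw ?h K (?h ` K)"
    using inj_on_to_nat_on[OF K] by (rule inj_on_imp_bij_betw)
  define V where "V i = (if i \<in> ?h ` K then U (the_inv_into K ?h i) else {})" for i
  have V: "V (?h k) = U k" if "k \<in> K" for k
    using that the_inv_into_f_f[OF inj_on_to_nat_on[OF K] that] by (auto simp: V_def)
  have "E \<subseteq> (\<Union>i. V i)" using cover V by blast
  moreover have "bounded (V i) \<and> diameter (V i) \<le> \<delta>" for i
  proof (cases "i \<in> ?h ` K")
    case True
    then show ?thesis using V small by auto
  qed (use \<open>0 \<le> \<delta>\<close> in \<open>auto simp: V_def\<close>)
  ultimately have "hausdorff_premeasure s \<delta> E \<le> (\<Sum>i. diam_pow s (V i))"
    unfolding hausdorff_premeasure_def by (intro INF_lower) auto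
  also have "\<dots> = (\<integral>\<^sup>+i. diam_pow s (V i) \<partial>count_space UNIV)"
    by (simp add: nn_integral_count_space_nat)
  also have "\<dots> = (\<integral>\<^sup>+i. diam_pow s (V i) * indicator (?h ` K) i \<partial>count_space UNIV)"
    by (intro nn_integral_cong) (auto simp: V_def diam_pow_def indicator_def)
  also have "\<dots> = (\<integral>\<^sup>+i. diam_pow s (V i) \<partial>count_space (?h ` K))"
    by (simp add: nn_integral_count_space_indicator)
  also have "\<dots> = (\<integral>\<^sup>+k. diam_pow s (V (?h k)) \<partial>count_space K)"
    by (rule nn_integral_bij_count_space[OF bij, symmetric])
  also have "\<dots> = (\<integral>\<^sup>+k. diam_pow s (U k) \<partial>count_space K)"
    by (intro nn_integral_cong) (simp add: V)
  finally show ?thesis .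
qed

lemma nn_integral_count_space_Sigma_nat:
  fixes f :: "nat \<times> 'b \<Rightarrow> ennreal"
  assumes fin: "\<And>m. finite (W m)"
  shows "(\<integral>\<^sup>+p. f p \<partial>count_space (SIGMA m:UNIV. W m)) = (\<Sum>m. \<Sum>w\<in>W m. f (m, w))"
proof -
  have "(\<integral>\<^sup>+p. f p \<partial>count_space (SIGMA m:UNIV. W m))
      = (\<integral>\<^sup>+p. f p * indicator (SIGMA m:UNIV. W m) p \<partial>count_space UNIV)"
    by (simp add: nn_integral_count_space_indicator)
  also have "\<dots> = (\<integral>\<^sup>+p. (\<Sum>m. f p * indicator ({m} \<times> W m) p) \<partial>count_space UNIV)"
  proof (intro nn_integral_cong)
    fix p :: "nat \<times> 'b"
    have "(\<Sum>m. f p * indicator ({m} \<times> W m) p) = (\<Sum>m\<in>{fst p}. f p * indicator ({m} \<times> W m) p)"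
      by (rule suminf_finite) (auto simp: indicator_def mem_Times_iff)
    then show "f p * indicator (SIGMA m:UNIV. W m) p = (\<Sum>m. f p * indicator ({m} \<times> W m) p)"
      by (cases p) (auto simp: indicator_def)
  qed
  also have "\<dots> = (\<Sum>m. \<integral>\<^sup>+p. f p * indicator ({m} \<times> W m) p \<partial>count_space UNIV)"
    by (rule nn_integral_suminf) simp
  also have "\<dots> = (\<Sum>m. \<Sum>w\<in>W m. f (m, w))"
  proof (intro suminf_cong)
    fix m
    have "(\<integral>\<^sup>+p. f p * indicator ({m} \<times> W m) p \<partial>count_space UNIV) = (\<integral>\<^sup>+p. f p \<partial>count_space ({m} \<times> W m))"
      by (simp add: nn_integral_count_space_indicator)
    also have "\<dots> = (\<Sum>p\<in>{m} \<times> W m. f p)"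
      by (rule nn_integral_count_space_finite) (use fin in simp)
    also have "\<dots> = (\<Sum>w\<in>W m. f (m, w))"
      by (simp add: sum.cartesian_product[symmetric, of "\<lambda>m w. f (m, w)", simplified])
    finally show "(\<integral>\<^sup>+p. f p * indicator ({m} \<times> W m) p \<partial>count_space UNIV) = (\<Sum>w\<in>W m. f (m, w))" .
  qed
  finally show ?thesis .
qed

context nonuniform_lengths
begin

definition cylinder :: "nat \<Rightarrow> (nat \<Rightarrow> nat) \<Rightarrow> real set" where
  "cylinder n w = {x \<in> inv_set. \<forall>j<n. itinerary x j = w j}"

definition words :: "nat \<Rightarrow> (nat \<Rightarrow> nat) set" where "words n = {..<n} \<rightarrow>\<^sub>E I"

lemma finite_words: "finite (words n)"
  unfolding words_def by (intro finite_PiE) (auto simp: finite_I)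

lemma inv_set_bounded: "U \<subseteq> inv_set \<Longrightarrow> bounded U"
  by (rule bounded_subset[of "{0..1::real}"]) (auto simp: inv_set_def invariant_set_def)

lemma diameter_cylinder:
  assumes "w \<in> words n" shows "diameter (cylinder n w) \<le> exp (- S w n)"
proof -
  have R: "R w n = exp (- S w n)" using assms by (intro R_eq_exp) (auto simp: words_def)
  show ?thesis
  proof (rule diameter_le)
    fix x y assume xy: "x \<in> cylinder n w" "y \<in> cylinder n w"
    then have "\<bar>x - y\<bar> \<le> R (itinerary x) n" by (intro dist_le_R) (auto simp: cylinder_def)
    also have "R (itinerary x) n = R w n" using xy by (intro R_cong) (auto simp: cylinder_def)
    finally show "norm (x - y) \<le> exp (- S w n)" by (simp add: R)
  qed simp
qed

lemma diam_pow_cylinder: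
  assumes "w \<in> words n" "0 < d"
  shows "diam_pow d (cylinder n w) \<le> ennreal (exp (- d * S w n))"
proof -
  have "diameter (cylinder n w) powr d \<le> exp (- S w n) powr d"
    using diameter_cylinder[OF assms(1)] assms(2)
    by (intro powr_mono2 diameter_ge_0 inv_set_bounded) (auto simp: cylinder_def)
  also have "\<dots> = exp (- d * S w n)" by (simp add: powr_def mult_ac)
  finally show ?thesis using assms(2) by (auto simp: diam_pow_def intro: ennreal_leI)
qed

text \<open>
  The product of the Gibbs weights of the first \<open>n\<close> letters, in the form that displays its
  exponential rate.
\<close>

definition mass :: "real \<Rightarrow> (nat \<Rightarrow> nat) \<Rightarrow> nat \<Rightarrow> real" where
  "mass s w n = exp (- (s * S w n) - n * pressure s)"

lemma mass_eq: "mass s w n = (\<Prod>j<n. gibbs s (w j))"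
  unfolding mass_def S_def gibbs_eq
  by (simp add: exp_sum[symmetric] sum_subtractf sum_negf sum_distrib_left mult.commute)

lemma sum_mass: "(\<Sum>w\<in>words n. mass s w n) = 1"
proof -
  have "(\<Prod>j<n. \<Sum>i\<in>I. gibbs s i) = (\<Sum>w\<in>words n. \<Prod>j<n. gibbs s (w j))"
    unfolding words_def by (rule prod_sum_PiE) (auto simp: finite_I)
  then show ?thesis by (simp add: mass_eq gibbs_sum)
qed

text \<open>
  For a point with Lyapunov exponent \<open>\<alpha>\<close> the cylinders around it eventually satisfy
  \<open>diameter powr d \<le> mass * exp (- \<eta> n)\<close>, because \<open>d\<close> exceeds the ratio of the exponential
  rates of mass and diameter. Summing over words of length \<open>n\<close> costs at most the total mass \<open>1\<close>,
  so the cover by all such cylinders of generations \<open>n \<ge> N\<close> is bounded by a geometric tail.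
\<close>

lemma hausdorff_measure_level_eq_0:
  assumes \<alpha>: "\<alpha> \<in> {a_min<..<a_max}" and d: "dim_formula \<alpha> < d"
  shows "hausdorff_measure d (level \<alpha>) = 0"
proof -
  define s where "s = temp \<alpha>"
  \<comment> \<open>Half of the surplus in the exponential rate; the other half absorbs the limit process.\<close>
  define \<eta> where "\<eta> = (\<alpha> * (d - s) - pressure s) / 2"
  have "0 < \<alpha>" using \<alpha> a_min_pos by simp
  have "0 < d" using dim_formula_nonneg[OF \<alpha>] d by simp
  have "pressure s < \<alpha> * (d - s)"
    using d \<open>0 < \<alpha>\<close> by (simp add: dim_formula_def s_def field_simps)
  then have \<eta>: "0 < \<eta>" by (simp add: \<eta>_def)
  define good where "good n w \<longleftrightarrow> real n * (pressure s + \<eta>) \<le> (d - s) * S w n" for n w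
  define W where "W n = {w \<in> words n. good n w}" for n
  have finW: "finite (W n)" for n using finite_words by (simp add: W_def)
  have le: "diam_pow d (cylinder n w) \<le> ennreal (mass s w n * exp (- \<eta>) ^ n)" if "w \<in> W n" for n w
  proof -
    have "diam_pow d (cylinder n w) \<le> ennreal (exp (- d * S w n))"
      using that \<open>0 < d\<close> by (intro diam_pow_cylinder) (auto simp: W_def)
    also have "exp (- d * S w n) \<le> mass s w n * exp (- \<eta>) ^ n"
      using that by (simp add: mass_def W_def good_def algebra_simps
          flip: exp_of_nat_mult exp_add)
    finally show ?thesis by (simp add: ennreal_leI)
  qed
  have "hausdorff_premeasure d \<delta> (level \<alpha>) = 0" if "0 < \<delta>" for \<delta>
  proof -
    define x where "x = exp (- \<eta>)"
    have x: "0 < x" "x < 1" using \<eta> by (auto simp: x_def)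
    have bound: "hausdorff_premeasure d \<delta> (level \<alpha>) \<le> ennreal (x ^ N * (1 / (1 - x)))"
      if N: "exp (- (real N * a_min)) \<le> \<delta>" for N
    proof -
      define K where "K = (SIGMA m:UNIV. W (m + N))"
      have "countable K" unfolding K_def using finW by (intro countable_SIGMA) (auto intro: countable_finite)
      moreover have "level \<alpha> \<subseteq> (\<Union>(m,w)\<in>K. cylinder (m + N) w)"
      proof
        fix y assume y: "y \<in> level \<alpha>"
        then have yi: "y \<in> inv_set" and lim: "(\<lambda>n. S (itinerary y) n / n) \<longlonglongrightarrow> \<alpha>" by (auto simp: level_def)
        have "(\<lambda>n. (d - s) * (S (itinerary y) n / n)) \<longlonglongrightarrow> (d - s) * \<alpha>"
          by (intro tendsto_intros lim)
        moreover have "pressure s + \<eta> < (d - s) * \<alpha>" using \<eta> by (simp add: \<eta>_def field_simps)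
        ultimately have "\<forall>\<^sub>F n in sequentially. pressure s + \<eta> < (d - s) * (S (itinerary y) n / n)"
          by (rule order_tendstoD(1))
        then have "\<forall>\<^sub>F n in sequentially. pressure s + \<eta> < (d - s) * (S (itinerary y) n / n) \<and> n \<ge> Suc N"
          using eventually_ge_at_top[of "Suc N"] by eventually_elim auto
        then obtain n where n: "pressure s + \<eta> < (d - s) * (S (itinerary y) n / n)" "n \<ge> Suc N"
          using eventually_happens by fastforce
        define w where "w = restrict (itinerary y) {..<n}"
        have "S w n = S (itinerary y) n" by (simp add: S_def w_def)
        then have "good n w" using n by (simp add: good_def field_simps)
        moreover have "w \<in> words n" using inv_setD(1)[OF yi] by (auto simp: words_def w_def)
        moreover have "y \<in> cylinder n w" using yi by (simp add: cylinder_def w_def)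
        ultimately have "(n - N, w) \<in> K" "y \<in> cylinder (n - N + N) w" using n by (auto simp: K_def W_def)
        then show "y \<in> (\<Union>(m,w)\<in>K. cylinder (m + N) w)" by blast
      qed
      moreover have "bounded (cylinder (m + N) w) \<and> diameter (cylinder (m + N) w) \<le> \<delta>" if "(m, w) \<in> K" for m w
      proof
        show "bounded (cylinder (m + N) w)" by (rule inv_set_bounded) (auto simp: cylinder_def)
        have w: "w \<in> words (m + N)" using that by (auto simp: K_def W_def)
        then have "real (m + N) * a_min \<le> S w (m + N)"
          using sum_bounded_below[of "{..<m + N}" a_min "\<lambda>j. a (w j)"] a_bounds
          by (fastforce simp: S_def words_def)
        moreover have "real N * a_min \<le> real (m + N) * a_min" using a_min_pos by simp
        ultimately have "exp (- S w (m + N)) \<le> exp (- (real N * a_min))" by simp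
        then show "diameter (cylinder (m + N) w) \<le> \<delta>" using diameter_cylinder[OF w] N by linarith
      qed
      ultimately have "hausdorff_premeasure d \<delta> (level \<alpha>)
          \<le> (\<integral>\<^sup>+p. diam_pow d ((\<lambda>(m, w). cylinder (m + N) w) p) \<partial>count_space K)"
        using \<open>0 < \<delta>\<close> by (intro hausdorff_premeasure_le_countable_cover) auto
      also have "\<dots> = (\<Sum>m. \<Sum>w\<in>W (m + N). diam_pow d (cylinder (m + N) w))"
        unfolding K_def by (subst nn_integral_count_space_Sigma_nat) (auto simp: finW)
      also have "\<dots> \<le> (\<Sum>m. ennreal (x ^ N * x ^ m))"
      proof (intro suminf_le)
        fix m
        let ?n = "m + N"
        have "(\<Sum>w\<in>W ?n. diam_pow d (cylinder ?n w)) \<le> (\<Sum>w\<in>W ?n. ennreal (mass s w ?n * x ^ ?n))"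
          using le by (intro sum_mono) (auto simp: x_def)
        also have "\<dots> = ennreal (\<Sum>w\<in>W ?n. mass s w ?n * x ^ ?n)"
          using x by (intro sum_ennreal) (auto simp: mass_def)
        also have "(\<Sum>w\<in>W ?n. mass s w ?n * x ^ ?n) \<le> (\<Sum>w\<in>words ?n. mass s w ?n * x ^ ?n)"
          using x by (intro sum_mono2 finite_words) (auto simp: W_def mass_def)
        also have "\<dots> = x ^ N * x ^ m"
          unfolding sum_distrib_right[symmetric] sum_mass by (simp add: power_add)
        finally show "(\<Sum>w\<in>W ?n. diam_pow d (cylinder ?n w)) \<le> ennreal (x ^ N * x ^ m)"
          by (simp add: ennreal_leI)
      qed auto
      also have "\<dots> = ennreal (\<Sum>m. x ^ N * x ^ m)"
        using x by (intro suminf_ennreal2 summable_mult summable_geometric) auto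
      also have "(\<Sum>m. x ^ N * x ^ m) = x ^ N * (1 / (1 - x))"
        using x by (simp add: suminf_mult suminf_geometric summable_geometric)
      finally show ?thesis .
    qed
    have "(\<lambda>N. exp (- (real N * a_min))) \<longlonglongrightarrow> 0"
    proof -
      have "(\<lambda>N. exp (- a_min) ^ N) \<longlonglongrightarrow> 0" using a_min_pos by (intro LIMSEQ_power_zero) auto
      then show ?thesis by (simp flip: exp_of_nat_mult)
    qed
    then have "\<forall>\<^sub>F N in sequentially. exp (- (real N * a_min)) < \<delta>"
      using \<open>0 < \<delta>\<close> by (rule order_tendstoD(2))
    then have "\<forall>\<^sub>F N in sequentially. hausdorff_premeasure d \<delta> (level \<alpha>) \<le> ennreal (x ^ N * (1 / (1 - x)))"
      by eventually_elim (use bound in auto)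
    moreover have "(\<lambda>N. ennreal (x ^ N * (1 / (1 - x)))) \<longlonglongrightarrow> ennreal (0 * (1 / (1 - x)))"
      using x by (intro tendsto_ennrealI tendsto_mult LIMSEQ_power_zero tendsto_const) auto
    ultimately have "hausdorff_premeasure d \<delta> (level \<alpha>) \<le> ennreal (0 * (1 / (1 - x)))"
      by (intro tendsto_lowerbound) auto
    then show ?thesis by simp
  qed
  then show ?thesis unfolding hausdorff_measure_def by (simp add: SUP_eq_const)
qed

end

section \<open>The strong law for bounded functions of independent letters\<close>

abbreviation bernoulli_measure :: "nat pmf \<Rightarrow> (nat \<Rightarrow> nat) measure" where
  "bernoulli_measure p \<equiv> Pi\<^sub>M UNIV (\<lambda>_. measure_pmf p)"

lemma prob_space_bernoulli: "prob_space (bernoulli_measure p)"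
  by (intro prob_space_PiM measure_pmf.prob_space_axioms)

lemma distr_letter: "distr (bernoulli_measure p) (measure_pmf p) (\<lambda>\<omega>. \<omega> j) = measure_pmf p"
  using distr_PiM_component[of UNIV "\<lambda>_. measure_pmf p" j] by (simp add: measure_pmf.prob_space_axioms)

lemma letter_measurable [measurable]:
  "(\<lambda>\<omega>. f (\<omega> j)) \<in> measurable (bernoulli_measure p) borel"
proof -
  have "(\<lambda>\<omega>. \<omega> j) \<in> measurable (bernoulli_measure p) (measure_pmf p)"
    by (rule measurable_component_singleton) simp
  then show ?thesis by (rule measurable_compose) simp
qed

lemma AE_letter_in_set_pmf: "AE \<omega> in bernoulli_measure p. \<forall>j. \<omega> j \<in> set_pmf p"
proof -
  have "AE \<omega> in bernoulli_measure p. \<omega> j \<in> set_pmf p" for j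
    by (rule AE_PiM_component) (auto simp: measure_pmf.prob_space_axioms AE_measure_pmf)
  then show ?thesis by (simp add: AE_all_countable)
qed

lemma indep_letters:
  fixes f :: "nat \<Rightarrow> real"
  assumes "J \<noteq> {}"
  shows "prob_space.indep_vars (bernoulli_measure p) (\<lambda>_. borel) (\<lambda>j \<omega>. f (\<omega> j)) J"
proof -
  interpret prob_space "bernoulli_measure p" by (rule prob_space_bernoulli)
  have "indep_vars (\<lambda>_. measure_pmf p) (\<lambda>j \<omega>. \<omega> j) UNIV"
  proof (subst indep_vars_iff_distr_eq_PiM')
    show "distr (bernoulli_measure p) (bernoulli_measure p) (\<lambda>\<omega>. \<lambda>i\<in>UNIV. \<omega> i)
        = (\<Pi>\<^sub>M i\<in>UNIV. distr (bernoulli_measure p) (measure_pmf p) (\<lambda>\<omega>. \<omega> i))"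
      by (simp add: distr_letter restrict_def)
  qed auto
  then have "indep_vars (\<lambda>_. borel) (\<lambda>j \<omega>. f (\<omega> j)) UNIV"
    by (rule indep_vars_compose2) simp
  then show ?thesis by (rule indep_vars_subset) simp
qed

text \<open>
  Hoeffding's inequality bounds the probability of a fixed deviation by a geometric sequence, so
  the Borel-Cantelli lemma applies to each deviation \<open>1 / Suc k\<close>.
\<close>

lemma strong_law_letters:
  fixes f :: "nat \<Rightarrow> real"
  assumes f: "\<And>i. i \<in> set_pmf p \<Longrightarrow> f i \<in> {b..c}" and "b < c"
  shows "AE \<omega> in bernoulli_measure p. (\<lambda>n. (\<Sum>j<n. f (\<omega> j)) / n) \<longlonglongrightarrow> measure_pmf.expectation p f"
proof -
  let ?M = "bernoulli_measure p" and ?e = "measure_pmf.expectation p f"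
  interpret prob_space ?M by (rule prob_space_bernoulli)
  have distr: "distr ?M borel (\<lambda>\<omega>. f (\<omega> j)) = distr (measure_pmf p) borel f" for j
  proof -
    have "distr (distr ?M (measure_pmf p) (\<lambda>\<omega>. \<omega> j)) borel f = distr ?M borel (f \<circ> (\<lambda>\<omega>. \<omega> j))"
      by (rule distr_distr) auto
    then show ?thesis by (simp add: distr_letter o_def)
  qed
  have mean: "expectation (\<lambda>\<omega>. f (\<omega> 0)) = ?e"
  proof -
    have "expectation (\<lambda>\<omega>. f (\<omega> 0)) = integral\<^sup>L (distr ?M (measure_pmf p) (\<lambda>\<omega>. \<omega> 0)) f"
      by (rule integral_distr[symmetric]) auto
    then show ?thesis by (simp add: distr_letter)
  qed
  have AE: "AE \<omega> in ?M. \<forall>\<^sub>F n in sequentially. \<bar>(\<Sum>j<n. f (\<omega> j)) / n - ?e\<bar> < \<epsilon>" if "0 < \<epsilon>" for \<epsilon> :: real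
  proof -
    define A where "A n = {\<omega> \<in> space ?M. \<bar>(\<Sum>j<Suc n. f (\<omega> j)) / real (Suc n) - ?e\<bar> \<ge> \<epsilon>}" for n
    have A [measurable]: "A n \<in> sets ?M" for n unfolding A_def by measurable
    define x where "x = exp (- 2 * \<epsilon>\<^sup>2 / (c - b)\<^sup>2)"
    have x: "0 < x" "x < 1" using that \<open>b < c\<close> by (auto simp: x_def)
    have le: "prob (A n) \<le> 2 * x ^ Suc n" for n
    proof -
      interpret H: Hoeffding_ineq_iid ?M "{..<Suc n}" "\<lambda>j \<omega>. f (\<omega> j)" "\<lambda>\<omega>. f (\<omega> 0)" b c ?e
      proof unfold_locales
        show "indep_vars (\<lambda>_. borel) (\<lambda>j \<omega>. f (\<omega> j)) {..<Suc n}" by (rule indep_letters) auto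
        show "AE \<omega> in ?M. f (\<omega> 0) \<in> {b..c}"
          using AE_letter_in_set_pmf by eventually_elim (use f in blast)
        show "?e \<equiv> expectation (\<lambda>\<omega>. f (\<omega> 0))" by (simp only: mean)
      qed (auto simp: distr simp del: lessThan_Suc)
      have "{..<Suc n} \<noteq> {}" by blast
      then have "prob (A n) \<le> 2 * exp (- 2 * real (card {..<Suc n}) * \<epsilon>\<^sup>2 / (c - b)\<^sup>2)"
        unfolding A_def using H.Hoeffding_ineq_abs_ge'[of \<epsilon>] that \<open>b < c\<close> by (simp del: sum.lessThan_Suc)
      also have "exp (- 2 * real (card {..<Suc n}) * \<epsilon>\<^sup>2 / (c - b)\<^sup>2) = x ^ Suc n"
        unfolding x_def exp_of_nat_mult[symmetric]
        by (simp add: algebra_simps add_divide_distrib diff_divide_distrib del: power_Suc)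
      finally show ?thesis .
    qed
    have "summable (\<lambda>n. prob (A n))"
    proof (rule summable_comparison_test)
      show "\<exists>N. \<forall>n\<ge>N. norm (prob (A n)) \<le> 2 * x ^ Suc n" using le by auto
      show "summable (\<lambda>n. 2 * x ^ Suc n)"
        using x by (intro summable_mult) (simp add: summable_geometric)
    qed
    then have "AE \<omega> in ?M. \<forall>\<^sub>F n in sequentially. \<omega> \<in> space ?M - A n"
      by (intro borel_cantelli_AE1 A) (auto simp: emeasure_eq_measure)
    then show ?thesis
    proof eventually_elim
      case (elim \<omega>)
      then have "\<forall>\<^sub>F n in sequentially. \<bar>(\<Sum>j<Suc n. f (\<omega> j)) / real (Suc n) - ?e\<bar> < \<epsilon>"
        by (rule eventually_mono) (simp add: A_def not_le del: sum.lessThan_Suc)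
      then show ?case
        by (subst (asm) eventually_sequentially_Suc[of "\<lambda>n. \<bar>(\<Sum>j<n. f (\<omega> j)) / real n - ?e\<bar> < \<epsilon>"])
    qed
  qed
  have "AE \<omega> in ?M. \<forall>k. \<forall>\<^sub>F n in sequentially. \<bar>(\<Sum>j<n. f (\<omega> j)) / n - ?e\<bar> < 1 / real (Suc k)"
    unfolding AE_all_countable by (intro allI AE) simp
  then show ?thesis
  proof eventually_elim
    case (elim \<omega>)
    show ?case
      unfolding tendsto_iff dist_real_def
    proof (intro allI impI)
      fix e :: real assume "0 < e"
      then obtain k where k: "1 / real (Suc k) < e" using nat_approx_posE by metis
      from elim have "\<forall>\<^sub>F n in sequentially. \<bar>(\<Sum>j<n. f (\<omega> j)) / n - ?e\<bar> < 1 / real (Suc k)" by blast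
      then show "\<forall>\<^sub>F n in sequentially. \<bar>(\<Sum>j<n. f (\<omega> j)) / n - ?e\<bar> < e"
        by (rule eventually_mono) (use k in linarith)
    qed
  qed
qed

section \<open>The lower bound for the dimension\<close>

context nonuniform_lengths
begin

definition gibbs_pmf :: "real \<Rightarrow> nat pmf" where
  "gibbs_pmf s = embed_pmf (\<lambda>i. if i \<in> I then gibbs s i else 0)"

abbreviation gibbs_measure :: "real \<Rightarrow> (nat \<Rightarrow> nat) measure" where
  "gibbs_measure s \<equiv> bernoulli_measure (gibbs_pmf s)"

lemma pmf_gibbs: "pmf (gibbs_pmf s) i = (if i \<in> I then gibbs s i else 0)"
  unfolding gibbs_pmf_def
proof (rule pmf_embed_pmf)
  have "(\<integral>\<^sup>+i. ennreal (if i \<in> I then gibbs s i else 0) \<partial>count_space UNIV)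
      = (\<Sum>i\<in>I. ennreal (if i \<in> I then gibbs s i else 0))"
    by (rule nn_integral_count_space') (auto simp: finite_I)
  also have "\<dots> = (\<Sum>i\<in>I. ennreal (gibbs s i))" by (intro sum.cong) auto
  also have "\<dots> = 1" using gibbs_sum[of s] gibbs_pos[of s] by (simp add: sum_ennreal less_imp_le)
  finally show "(\<integral>\<^sup>+i. ennreal (if i \<in> I then gibbs s i else 0) \<partial>count_space UNIV) = 1" .
qed (use gibbs_pos[of s] in \<open>auto simp: less_imp_le\<close>)

lemma set_gibbs: "set_pmf (gibbs_pmf s) = I"
  using gibbs_pos[of s] by (auto simp: set_pmf_eq pmf_gibbs less_imp_neq[symmetric])

lemma expectation_gibbs: "measure_pmf.expectation (gibbs_pmf s) a = mean s"
proof -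
  have "measure_pmf.expectation (gibbs_pmf s) a = (\<Sum>i\<in>I. a i * pmf (gibbs_pmf s) i)"
    by (rule integral_measure_pmf_real) (auto simp: finite_I set_gibbs)
  then show ?thesis by (simp add: pmf_gibbs mean_def mult.commute)
qed

lemma AE_exponent: "AE \<omega> in gibbs_measure s. (\<lambda>n. S \<omega> n / n) \<longlonglongrightarrow> mean s"
  using strong_law_letters[of "gibbs_pmf s" a a_min a_max] a_bounds a_min_less_max
  by (simp add: set_gibbs expectation_gibbs S_def)

lemma emeasure_cylinder:
  assumes "\<And>j. j < n \<Longrightarrow> w j \<in> I"
  shows "{\<omega> \<in> space (gibbs_measure s). \<forall>j<n. \<omega> j = w j} \<in> sets (gibbs_measure s)"
    and "emeasure (gibbs_measure s) {\<omega> \<in> space (gibbs_measure s). \<forall>j<n. \<omega> j = w j} = ennreal (mass s w n)"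
proof -
  interpret product_prob_space "\<lambda>_. measure_pmf (gibbs_pmf s)" UNIV
    by (intro product_prob_spaceI measure_pmf.prob_space_axioms)
  have eq: "{\<omega> \<in> space (gibbs_measure s). \<forall>j<n. \<omega> j = w j}
      = {\<omega> \<in> space (gibbs_measure s). \<forall>j\<in>{..<n}. \<omega> j \<in> {w j}}" by auto
  \<comment> \<open>Letters are compared as real numbers, where equality is known to be a measurable predicate.\<close>
  have "(\<lambda>\<omega>. real (\<omega> j)) \<in> borel_measurable (gibbs_measure s)" for j by (rule letter_measurable)
  then have "{\<omega> \<in> space (gibbs_measure s). \<forall>j<n. real (\<omega> j) = real (w j)} \<in> sets (gibbs_measure s)"
    by measurable
  then show "{\<omega> \<in> space (gibbs_measure s). \<forall>j<n. \<omega> j = w j} \<in> sets (gibbs_measure s)" by simp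
  have "emeasure (gibbs_measure s) {\<omega> \<in> space (gibbs_measure s). \<forall>j<n. \<omega> j = w j}
      = (\<Prod>j<n. emeasure (measure_pmf (gibbs_pmf s)) {w j})"
    unfolding eq by (rule emeasure_PiM_Collect) auto
  also have "\<dots> = (\<Prod>j<n. ennreal (gibbs s (w j)))"
    by (intro prod.cong) (use assms in \<open>auto simp: emeasure_pmf_single pmf_gibbs\<close>)
  also have "\<dots> = ennreal (mass s w n)"
    unfolding mass_eq using gibbs_pos[of s] by (intro prod_ennreal) (auto simp: less_imp_le)
  finally show "emeasure (gibbs_measure s) {\<omega> \<in> space (gibbs_measure s). \<forall>j<n. \<omega> j = w j} = ennreal (mass s w n)" .
qed

text \<open>
  The inequality says \<open>mass s \<omega> n \<le> R \<omega> n powr d\<close> in logarithmic form: from generation \<open>n0\<close> on, the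
  Gibbs measure has local dimension at least \<open>d\<close> along the code \<open>\<omega>\<close>.
\<close>

definition regular :: "real \<Rightarrow> real \<Rightarrow> nat \<Rightarrow> (nat \<Rightarrow> nat) set" where
  "regular s d n0 = {\<omega>. (\<forall>j. \<omega> j \<in> I) \<and> (\<forall>n\<ge>n0. (d - s) * S \<omega> n \<le> n * pressure s)}"

text \<open>
  A set of diameter at most \<open>\<rho>\<close> cannot meet two cylinders of a generation before the gaps
  become smaller than \<open>\<rho>\<close>, so it lies in one cylinder of diameter at most \<open>\<rho> / gap\<close>. The
  bound on \<open>\<rho>\<close> pushes the generation of this cylinder beyond \<open>n0\<close>, where regularity controls its mass.
\<close>

lemma small_set_in_cylinder:
  assumes U: "bounded U" "diameter U \<le> \<rho>" and \<rho>: "0 < \<rho>" "\<rho> < gap * exp (- (n0 * a_max))" and "0 \<le> d"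
  shows "\<exists>C\<in>sets (gibbs_measure s). {\<omega> \<in> space (gibbs_measure s) \<inter> regular s d n0. pt \<omega> \<in> U} \<subseteq> C \<and>
    emeasure (gibbs_measure s) C \<le> ennreal ((\<rho> / gap) powr d)"
proof (cases "{\<omega> \<in> space (gibbs_measure s) \<inter> regular s d n0. pt \<omega> \<in> U} = {}")
  case True
  then show ?thesis by (intro bexI[of _ "{}"]) auto
next
  case False
  then obtain w where w: "w \<in> regular s d n0" "pt w \<in> U" by auto
  then have wI: "\<And>j. w j \<in> I" by (simp add: regular_def)
  have R: "R w n = exp (- S w n)" for n using wI by (intro R_eq_exp)
  have "\<exists>n. gap * R w n \<le> \<rho>"
  proof -
    have "(\<lambda>n. exp (- a_min) ^ n) \<longlonglongrightarrow> 0" using a_min_pos by (intro LIMSEQ_power_zero) auto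
    then have "\<forall>\<^sub>F n in sequentially. exp (- a_min) ^ n < \<rho> / gap"
      using \<rho> gap_pos by (intro order_tendstoD(2)) auto
    then obtain n where n: "exp (- a_min) ^ n < \<rho> / gap" using eventually_happens by fastforce
    have "R w n \<le> exp (- a_min) ^ n"
      using S_bounds(1)[of w n, OF wI] by (simp add: R flip: exp_of_nat_mult)
    then have "R w n \<le> \<rho> / gap" using n by simp
    then show ?thesis using gap_pos by (intro exI[of _ n]) (simp add: field_simps)
  qed
  define n where "n = (LEAST n. gap * R w n \<le> \<rho>)"
  have n: "gap * R w n \<le> \<rho>" unfolding n_def by (rule LeastI_ex) fact
  have before: "\<rho> < gap * R w j" if "j < n" for j
    using not_less_Least[of j "\<lambda>n. gap * R w n \<le> \<rho>"] that by (simp add: n_def)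
  have "n0 \<le> n"
  proof (rule ccontr)
    assume "\<not> n0 \<le> n"
    have "S w n \<le> n * a_max" using S_bounds(2)[of w n, OF wI] .
    also have "\<dots> \<le> n0 * a_max"
      using \<open>\<not> n0 \<le> n\<close> a_min_pos a_min_less_max by (intro mult_right_mono) auto
    finally have "exp (- (n0 * a_max)) \<le> R w n" by (simp add: R)
    then have "gap * exp (- (n0 * a_max)) \<le> \<rho>"
      using n gap_pos by (meson mult_left_mono less_imp_le order_trans)
    then show False using \<rho> by simp
  qed
  show ?thesis
  proof (intro bexI conjI)
    let ?C = "{\<omega> \<in> space (gibbs_measure s). \<forall>j<n. \<omega> j = w j}"
    show "?C \<in> sets (gibbs_measure s)" using wI by (rule emeasure_cylinder)
    show "{\<omega> \<in> space (gibbs_measure s) \<inter> regular s d n0. pt \<omega> \<in> U} \<subseteq> ?C"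
    proof
      fix \<omega> assume "\<omega> \<in> {\<omega> \<in> space (gibbs_measure s) \<inter> regular s d n0. pt \<omega> \<in> U}"
      then have \<omega>: "\<omega> \<in> space (gibbs_measure s)" "\<And>j. \<omega> j \<in> I" "pt \<omega> \<in> U" by (auto simp: regular_def)
      have "\<bar>pt w - pt \<omega>\<bar> \<le> \<rho>"
        using diameter_bounded_bound[OF U(1) w(2) \<omega>(3)] U(2) by (simp add: dist_real_def)
      then have "\<And>j. j < n \<Longrightarrow> \<bar>pt w - pt \<omega>\<bar> < gap * R (itinerary (pt w)) j"
        using before pt_itinerary(2)[of w, OF wI] by fastforce
      from same_itinerary_if_close[OF pt_itinerary(1)[of w, OF wI] pt_itinerary(1)[of \<omega>, OF \<omega>(2)] this]
      have "\<And>j. j < n \<Longrightarrow> itinerary (pt w) j = itinerary (pt \<omega>) j" by blast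
      then show "\<omega> \<in> ?C"
        using \<omega>(1) pt_itinerary(2)[of w, OF wI] pt_itinerary(2)[of \<omega>, OF \<omega>(2)] by auto
    qed
    have "emeasure (gibbs_measure s) ?C = ennreal (mass s w n)" using wI by (rule emeasure_cylinder)
    also have "mass s w n \<le> exp (- S w n * d)"
      using w(1) \<open>n0 \<le> n\<close> by (auto simp: regular_def mass_def algebra_simps)
    also have "\<dots> = R w n powr d" by (simp add: R powr_def mult.commute)
    also have "\<dots> \<le> (\<rho> / gap) powr d"
      using n gap_pos \<open>0 \<le> d\<close> by (intro powr_mono2) (auto simp: R field_simps)
    finally show "emeasure (gibbs_measure s) ?C \<le> ennreal ((\<rho> / gap) powr d)"
      by (simp add: ennreal_leI)
  qed
qed

text \<open>
  The set of codes of points of \<open>U\<close> is enclosed in a measurable set, as countable subadditivity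
  of the measure requires. If \<open>U\<close> has positive diameter, this diameter is the scale at which the
  previous lemma is applied.
\<close>

lemma small_set_mass:
  assumes U: "bounded U" "diameter U \<le> gap * exp (- (n0 * a_max)) / 2" and "0 \<le> d"
  shows "\<exists>C\<in>sets (gibbs_measure s). {\<omega> \<in> space (gibbs_measure s) \<inter> regular s d n0. pt \<omega> \<in> U} \<subseteq> C \<and>
    emeasure (gibbs_measure s) C \<le> ennreal (gap powr (- d)) * diam_pow d U"
proof -
  interpret prob_space "gibbs_measure s" by (rule prob_space_bernoulli)
  define \<delta> where "\<delta> = gap * exp (- (n0 * a_max)) / 2"
  have \<delta>: "0 < \<delta>" "\<And>\<rho>. \<rho> \<le> \<delta> \<Longrightarrow> \<rho> < gap * exp (- (n0 * a_max))" using gap_pos by (simp add: \<delta>_def)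
    (use mult_pos_pos[OF gap_pos exp_gt_zero, of "- (n0 * a_max)"] in \<open>simp add: \<delta>_def\<close>)
  consider "U = {}" | "U \<noteq> {}" "d = 0" | "U \<noteq> {}" "0 < d" "0 < diameter U" | "U \<noteq> {}" "0 < d" "diameter U = 0"
    using diameter_ge_0[OF U(1)] \<open>0 \<le> d\<close> by linarith
  then show ?thesis
  proof cases
    case 1
    then show ?thesis by (intro bexI[of _ "{}"]) auto
  next
    case 2
    then show ?thesis using gap_pos
      by (intro bexI[of _ "space (gibbs_measure s)"]) (auto simp: diam_pow_def emeasure_space_1)
  next
    case 3
    have "(diameter U / gap) powr d = gap powr (- d) * diameter U powr d"
      using 3 gap_pos by (simp add: powr_divide powr_minus field_simps)
    then have "ennreal ((diameter U / gap) powr d) = ennreal (gap powr (- d)) * diam_pow d U"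
      using 3 by (simp add: diam_pow_def ennreal_mult)
    then show ?thesis
      using small_set_in_cylinder[OF U(1) order_refl 3(3) \<delta>(2) \<open>0 \<le> d\<close>, of s] U(2) by (simp add: \<delta>_def)
  next
    case 4
    \<comment> \<open>A one-point set lies in arbitrarily small cylinders.\<close>
    define \<rho> where "\<rho> k = \<delta> / real (Suc k)" for k
    have \<rho>: "0 < \<rho> k" "\<rho> k < gap * exp (- (n0 * a_max))" for k
    proof -
      show "0 < \<rho> k" using \<delta>(1) by (simp add: \<rho>_def)
      have "\<rho> k \<le> \<delta>" using \<delta>(1) by (simp add: \<rho>_def divide_le_eq mult_left_le)
      then show "\<rho> k < gap * exp (- (n0 * a_max))" by (rule \<delta>(2))
    qed
    have "\<forall>k. \<exists>C. C \<in> sets (gibbs_measure s) \<and>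
      {\<omega> \<in> space (gibbs_measure s) \<inter> regular s d n0. pt \<omega> \<in> U} \<subseteq> C \<and>
      emeasure (gibbs_measure s) C \<le> ennreal ((\<rho> k / gap) powr d)"
    proof
      fix k
      have "diameter U \<le> \<rho> k" using \<rho>(1)[of k] 4 by simp
      from small_set_in_cylinder[OF U(1) this \<rho> \<open>0 \<le> d\<close>, of s]
      show "\<exists>C. C \<in> sets (gibbs_measure s) \<and>
        {\<omega> \<in> space (gibbs_measure s) \<inter> regular s d n0. pt \<omega> \<in> U} \<subseteq> C \<and>
        emeasure (gibbs_measure s) C \<le> ennreal ((\<rho> k / gap) powr d)" by blast
    qed
    from choice[OF this] obtain C where C: "\<And>k. C k \<in> sets (gibbs_measure s)"
      "\<And>k. {\<omega> \<in> space (gibbs_measure s) \<inter> regular s d n0. pt \<omega> \<in> U} \<subseteq> C k"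
      "\<And>k. emeasure (gibbs_measure s) (C k) \<le> ennreal ((\<rho> k / gap) powr d)" by blast
    have "(\<lambda>k. \<delta> * inverse (real (Suc k))) \<longlonglongrightarrow> \<delta> * 0"
      by (intro tendsto_mult tendsto_const LIMSEQ_inverse_real_of_nat)
    then have "\<rho> \<longlonglongrightarrow> 0" by (simp add: \<rho>_def[abs_def] divide_inverse)
    then have "(\<lambda>k. \<rho> k / gap) \<longlonglongrightarrow> 0" by (rule tendsto_divide_zero)
    then have "(\<lambda>k. (\<rho> k / gap) powr d) \<longlonglongrightarrow> 0"
      by (rule tendsto_zero_powrI[where b=d]) (use 4 \<rho>(1) gap_pos in \<open>auto simp: less_imp_le\<close>)
    then have "(\<lambda>k. ennreal ((\<rho> k / gap) powr d)) \<longlonglongrightarrow> ennreal 0" by (rule tendsto_ennrealI)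
    moreover have "emeasure (gibbs_measure s) (\<Inter>k. C k) \<le> ennreal ((\<rho> k / gap) powr d)" for k
      using C(3)[of k] emeasure_mono[of "\<Inter>k. C k" "C k" "gibbs_measure s"] C(1) by (auto intro: order_trans)
    ultimately have "emeasure (gibbs_measure s) (\<Inter>k. C k) \<le> ennreal 0"
      by (intro tendsto_lowerbound[of _ _ sequentially]) auto
    then show ?thesis using C by (intro bexI[of _ "\<Inter>k. C k"]) (auto intro!: sets.countable_INT'')
  qed
qed

text \<open>
  The mass distribution principle. By the strong law, the Gibbs measure of mean \<open>\<alpha>\<close> is carried by
  codes of points in \<open>level \<alpha>\<close>, and since \<open>d\<close> is smaller than the ratio of the rates of mass and
  diameter, almost every code is regular for some \<open>n0\<close>. One such set \<open>G n0\<close> of codes has positive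
  mass, which every fine cover of the level set has to pay for.
\<close>

lemma hausdorff_measure_level_pos:
  assumes \<alpha>: "\<alpha> \<in> {a_min<..<a_max}" and d: "0 \<le> d" "d < dim_formula \<alpha>"
  shows "hausdorff_measure d (level \<alpha>) \<noteq> 0"
proof -
  define s where "s = temp \<alpha>"
  let ?M = "gibbs_measure s"
  interpret prob_space ?M by (rule prob_space_bernoulli)
  have "0 < \<alpha>" using \<alpha> a_min_pos by simp
  then have rate: "(d - s) * \<alpha> < pressure s"
    using d by (simp add: dim_formula_def s_def field_simps)
  have "AE \<omega> in ?M. (\<forall>j. \<omega> j \<in> I) \<and> (\<lambda>n. S \<omega> n / n) \<longlonglongrightarrow> \<alpha>"
    using AE_letter_in_set_pmf[of "gibbs_pmf s"] AE_exponent[of s]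
    by eventually_elim (use mean_temp[OF \<alpha>] in \<open>simp add: set_gibbs s_def\<close>)
  then obtain N where N: "N \<in> null_sets ?M"
    "\<And>\<omega>. \<omega> \<in> space ?M - N \<Longrightarrow> (\<forall>j. \<omega> j \<in> I) \<and> (\<lambda>n. S \<omega> n / n) \<longlonglongrightarrow> \<alpha>"
    unfolding eventually_ae_filter by blast
  define G where "G n0 = {\<omega> \<in> space ?M. \<forall>n\<ge>n0. (d - s) * S \<omega> n \<le> n * pressure s} - N" for n0
  have [measurable]: "(\<lambda>\<omega>. S \<omega> n) \<in> borel_measurable ?M" for n unfolding S_def by measurable
  have G: "G n0 \<in> sets ?M" for n0
    unfolding G_def by (intro sets.Diff null_setsD2[OF N(1)]) measurable
  have "space ?M - N \<subseteq> (\<Union>n0. G n0)"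
  proof
    fix \<omega> assume \<omega>: "\<omega> \<in> space ?M - N"
    then have "(\<lambda>n. (d - s) * (S \<omega> n / n)) \<longlonglongrightarrow> (d - s) * \<alpha>"
      using N(2) by (intro tendsto_intros) auto
    from order_tendstoD(2)[OF this rate]
    have "\<forall>\<^sub>F n in sequentially. (d - s) * S \<omega> n \<le> n * pressure s"
      using eventually_gt_at_top[of 0] by eventually_elim (simp add: field_simps)
    then show "\<omega> \<in> (\<Union>n0. G n0)" using \<omega> by (auto simp: eventually_sequentially G_def)
  qed
  moreover have "emeasure ?M (space ?M - N) = 1"
    using N(1) by (simp add: emeasure_Diff_null_set emeasure_space_1)
  ultimately have "1 \<le> emeasure ?M (\<Union>n0. G n0)"
    using G by (metis (no_types, lifting) emeasure_mono sets.countable_UN image_subset_iff)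
  then obtain n0 where n0: "emeasure ?M (G n0) \<noteq> 0"
    using emeasure_UN_eq_0[of ?M G] G by fastforce
  define \<delta> where "\<delta> = gap * exp (- (n0 * a_max)) / 2"
  have "0 < \<delta>" using gap_pos by (simp add: \<delta>_def)
  have G_sub: "G n0 \<subseteq> space ?M \<inter> regular s d n0" using N(2) by (auto simp: G_def regular_def)
  have G_level: "pt \<omega> \<in> level \<alpha>" if "\<omega> \<in> G n0" for \<omega>
  proof -
    have "\<And>j. \<omega> j \<in> I" "(\<lambda>n. S \<omega> n / n) \<longlonglongrightarrow> \<alpha>" using that N(2)[of \<omega>] by (auto simp: G_def)
    then show ?thesis using pt_itinerary[of \<omega>] by (simp add: level_def)
  qed
  have "ennreal (gap powr d) * emeasure ?M (G n0) \<le> hausdorff_premeasure d \<delta> (level \<alpha>)"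
    unfolding hausdorff_premeasure_def
  proof (rule INF_greatest)
    fix U assume "U \<in> {U :: nat \<Rightarrow> real set. level \<alpha> \<subseteq> (\<Union>i. U i) \<and> (\<forall>i. bounded (U i) \<and> diameter (U i) \<le> \<delta>)}"
    then have U: "level \<alpha> \<subseteq> (\<Union>i. U i)" "\<And>i. bounded (U i)" "\<And>i. diameter (U i) \<le> \<delta>" by auto
    have "\<forall>i. \<exists>C. C \<in> sets ?M \<and> {\<omega> \<in> space ?M \<inter> regular s d n0. pt \<omega> \<in> U i} \<subseteq> C \<and>
        emeasure ?M C \<le> ennreal (gap powr (- d)) * diam_pow d (U i)"
    proof
      fix i
      show "\<exists>C. C \<in> sets ?M \<and> {\<omega> \<in> space ?M \<inter> regular s d n0. pt \<omega> \<in> U i} \<subseteq> C \<and>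
          emeasure ?M C \<le> ennreal (gap powr (- d)) * diam_pow d (U i)"
        using small_set_mass[OF U(2) _ d(1), of i n0 s] U(3)[of i] unfolding \<delta>_def by blast
    qed
    from choice[OF this] obtain C where C: "\<And>i. C i \<in> sets ?M"
      "\<And>i. {\<omega> \<in> space ?M \<inter> regular s d n0. pt \<omega> \<in> U i} \<subseteq> C i"
      "\<And>i. emeasure ?M (C i) \<le> ennreal (gap powr (- d)) * diam_pow d (U i)" by blast
    have "G n0 \<subseteq> (\<Union>i. C i)"
    proof
      fix \<omega> assume \<omega>: "\<omega> \<in> G n0"
      then obtain i where "pt \<omega> \<in> U i" using G_level U(1) by blast
      then show "\<omega> \<in> (\<Union>i. C i)" using C(2)[of i] \<omega> G_sub by blast
    qed
    then have "emeasure ?M (G n0) \<le> emeasure ?M (\<Union>i. C i)"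
      by (rule emeasure_mono) (use C(1) in auto)
    also have "\<dots> \<le> (\<Sum>i. emeasure ?M (C i))"
      by (rule emeasure_subadditive_countably) (use C(1) in auto)
    also have "\<dots> \<le> (\<Sum>i. ennreal (gap powr (- d)) * diam_pow d (U i))"
      by (intro suminf_le C(3)) auto
    also have "\<dots> = ennreal (gap powr (- d)) * (\<Sum>i. diam_pow d (U i))" by (rule ennreal_suminf_cmult)
    finally have "ennreal (gap powr d) * emeasure ?M (G n0)
        \<le> ennreal (gap powr d) * (ennreal (gap powr (- d)) * (\<Sum>i. diam_pow d (U i)))"
      by (rule mult_left_mono) simp
    also have "\<dots> = ennreal (gap powr d * gap powr (- d)) * (\<Sum>i. diam_pow d (U i))"
      by (simp add: ennreal_mult mult.assoc)
    also have "gap powr d * gap powr (- d) = 1" using gap_pos by (simp flip: powr_add)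
    finally show "ennreal (gap powr d) * emeasure ?M (G n0) \<le> (\<Sum>i. diam_pow d (U i))" by simp
  qed
  moreover have "0 < ennreal (gap powr d) * emeasure ?M (G n0)"
    using n0 gap_pos by (simp add: ennreal_zero_less_mult_iff zero_less_iff_neq_zero)
  ultimately have "0 < hausdorff_premeasure d \<delta> (level \<alpha>)" by simp
  also have "\<dots> \<le> hausdorff_measure d (level \<alpha>)"
    unfolding hausdorff_measure_def using \<open>0 < \<delta>\<close> by (intro SUP_upper) auto
  finally show ?thesis by simp
qed

section \<open>The Lyapunov spectrum\<close>

text \<open>For the Gibbs measure of mean \<open>\<alpha>\<close>, almost every code has exponent \<open>\<alpha>\<close>.\<close>

lemma level_nonempty:
  assumes \<alpha>: "\<alpha> \<in> {a_min<..<a_max}" shows "level \<alpha> \<noteq> {}"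
proof -
  let ?M = "gibbs_measure (temp \<alpha>)"
  interpret prob_space ?M by (rule prob_space_bernoulli)
  have "AE \<omega> in ?M. (\<forall>j. \<omega> j \<in> I) \<and> (\<lambda>n. S \<omega> n / n) \<longlonglongrightarrow> \<alpha>"
    using AE_letter_in_set_pmf[of "gibbs_pmf (temp \<alpha>)"] AE_exponent[of "temp \<alpha>"]
    by eventually_elim (use mean_temp[OF \<alpha>] in \<open>simp add: set_gibbs\<close>)
  then obtain \<omega> where "\<forall>j. \<omega> j \<in> I" "(\<lambda>n. S \<omega> n / n) \<longlonglongrightarrow> \<alpha>"
    using eventually_happens'[OF ae_filter_bot] by blast
  then have "pt \<omega> \<in> level \<alpha>" using pt_itinerary[of \<omega>] by (simp add: level_def)
  then show ?thesis by blast
qed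

theorem interior_lyapunov_values: "interior (lyapunov_values q X T) = {a_min<..<a_max}"
proof -
  have eq: "lyapunov_values q X T = {\<alpha>. level \<alpha> \<noteq> {}}"
    unfolding lyapunov_values_def level_eq by auto
  have "{a_min<..<a_max} \<subseteq> lyapunov_values q X T" using level_nonempty by (auto simp: eq)
  then have "{a_min<..<a_max} \<subseteq> interior (lyapunov_values q X T)" by (rule interior_maximal) simp
  moreover have "lyapunov_values q X T \<subseteq> {a_min..a_max}" using level_exponent_bounds by (fastforce simp: eq)
  then have "interior (lyapunov_values q X T) \<subseteq> interior {a_min..a_max}" by (rule interior_mono)
  ultimately show ?thesis by (simp add: interior_atLeastAtMost_real)
qed

theorem lyapunov_spectrum_eq:
  assumes \<alpha>: "\<alpha> \<in> {a_min<..<a_max}"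
  shows "lyapunov_spectrum q X T \<alpha> = dim_formula \<alpha>"
proof -
  have "hausdorff_dim (level \<alpha>) = ennreal (dim_formula \<alpha>)"
    unfolding hausdorff_dim_def
  proof (rule antisym)
    show "Inf {ennreal d |d. 0 \<le> d \<and> hausdorff_measure d (level \<alpha>) = 0} \<le> ennreal (dim_formula \<alpha>)"
    proof (rule ennreal_le_epsilon)
      fix e :: real assume "0 < e"
      then have "Inf {ennreal d |d. 0 \<le> d \<and> hausdorff_measure d (level \<alpha>) = 0} \<le> ennreal (dim_formula \<alpha> + e)"
        using hausdorff_measure_level_eq_0[OF \<alpha>, of "dim_formula \<alpha> + e"] dim_formula_nonneg[OF \<alpha>]
          \<open>0 < e\<close>
        by (intro Inf_lower CollectI exI[of _ "dim_formula \<alpha> + e"]) auto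
      then show "Inf {ennreal d |d. 0 \<le> d \<and> hausdorff_measure d (level \<alpha>) = 0}
          \<le> ennreal (dim_formula \<alpha>) + ennreal e"
        using dim_formula_nonneg[OF \<alpha>] \<open>0 < e\<close> by (simp add: ennreal_plus)
    qed
    show "ennreal (dim_formula \<alpha>) \<le> Inf {ennreal d |d. 0 \<le> d \<and> hausdorff_measure d (level \<alpha>) = 0}"
    proof (rule Inf_greatest, clarify)
      fix d :: real assume "0 \<le> d" "hausdorff_measure d (level \<alpha>) = 0"
      then have "\<not> d < dim_formula \<alpha>" using hausdorff_measure_level_pos[OF \<alpha>] by blast
      then show "ennreal (dim_formula \<alpha>) \<le> ennreal d" by (simp add: ennreal_leI)
    qed
  qed
  then show ?thesis
    using dim_formula_nonneg[OF \<alpha>] by (simp add: lyapunov_spectrum_def flip: level_eq)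
qed

end

section \<open>A spectrum that crosses a line many times\<close>

lemma sum_over_levels:
  fixes F :: "nat \<Rightarrow> real"
  assumes "finite A" "lev ` A \<subseteq> B" "finite B"
  shows "(\<Sum>j\<in>A. F (lev j)) = (\<Sum>i\<in>B. real (card {j \<in> A. lev j = i}) * F i)"
proof -
  have "(\<Sum>j\<in>A. F (lev j)) = (\<Sum>i\<in>B. \<Sum>j\<in>{j \<in> A. lev j = i}. F (lev j))"
    using sum.group[OF assms(1,3,2), of "\<lambda>j. F (lev j)"] by simp
  also have "\<dots> = (\<Sum>i\<in>B. real (card {j \<in> A. lev j = i}) * F i)"
    by (intro sum.cong) auto
  finally show ?thesis .
qed

text \<open>
  There are \<open>exp (b * i * (2 * m - i))\<close> branches of length \<open>exp (- 2 * m * b * i)\<close> for each level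
  \<open>i = 1..m\<close>. With the exponent measured in units of \<open>2 * m * b\<close>, the logarithmic number of
  branches of level \<open>x\<close> is the concave parabola \<open>b * x * (2 * m - x)\<close>. It is chosen so that its
  quotient by the exponent is affine in \<open>x\<close>, and the coefficient \<open>2 * m\<close> in the lengths
  leaves room for all branches: the lengths of level \<open>i\<close> add up to \<open>exp (- b * i\<^sup>2)\<close>.
  For large \<open>b\<close> the entropy is close to the polygon inscribed in the parabola with vertices at
  the integers; \<open>ln m\<close> bounds the error, and \<open>b / 4\<close> is the distance between polygon and parabola
  at the midpoints.
\<close>

locale parabolic_levels = nonuniform_lengths q r for q r +
  fixes m :: nat and b :: real and lev :: "nat \<Rightarrow> nat"
  assumes b: "0 < b" "ln m < b / 4"
    and lev: "lev ` {1..q} = {1..m}"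
    and length_level: "j \<in> {1..q} \<Longrightarrow> r j = exp (- 2 * real m * b * lev j)"
    and card_level: "i \<in> {1..m} \<Longrightarrow> card {j \<in> {1..q}. lev j = i} = exp (b * i * (2 * real m - i))"
begin

definition \<Lambda> :: real where "\<Lambda> = 2 * m * b"

lemma m_pos: "1 \<le> m"
proof -
  have "1 \<in> {1..q}" using two_le_q by simp
  then have "lev 1 \<in> {1..m}" using lev by blast
  then show ?thesis by simp
qed

lemma \<Lambda>_pos: "0 < \<Lambda>" using b m_pos by (simp add: \<Lambda>_def)

lemma a_level: "j \<in> I \<Longrightarrow> a j = \<Lambda> * lev j"
  using length_level[of j] by (simp add: a_def \<Lambda>_def I_def)

lemma partition_sum_levels: "partition_sum s = (\<Sum>i\<in>{1..m}. exp (b * i * (2 * real m - i) - \<Lambda> * i * s))"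
proof -
  have "partition_sum s = (\<Sum>j\<in>I. exp (- (\<Lambda> * lev j) * s))"
    unfolding partition_sum_def by (intro sum.cong) (auto simp: a_level)
  also have "\<dots> = (\<Sum>i\<in>{1..m}. real (card {j \<in> I. lev j = i}) * exp (- (\<Lambda> * i) * s))"
    using lev by (intro sum_over_levels[where F="\<lambda>i. exp (- (\<Lambda> * real i) * s)"]) (auto simp: I_def)
  also have "\<dots> = (\<Sum>i\<in>{1..m}. exp (b * i * (2 * real m - i) - \<Lambda> * i * s))"
    by (intro sum.cong) (use card_level in \<open>auto simp: I_def exp_diff exp_minus divide_inverse\<close>)
  finally show ?thesis .
qed

lemma level_range:
  fixes x :: real
  assumes "1 < x" "x < m" shows "\<Lambda> * x \<in> {a_min<..<a_max}"
proof -
  have "1 \<in> lev ` I" "m \<in> lev ` I" using lev m_pos by (auto simp: I_def)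
  then obtain j k where "j \<in> I" "lev j = 1" "k \<in> I" "lev k = m" by auto
  then have "a_min \<le> \<Lambda>" "\<Lambda> * m \<le> a_max" using a_bounds[of j] a_bounds[of k] a_level by auto
  moreover have "\<Lambda> < \<Lambda> * x" "\<Lambda> * x < \<Lambda> * m" using \<Lambda>_pos assms by auto
  ultimately show ?thesis by auto
qed

definition line :: "real \<Rightarrow> real" where "line \<alpha> = 1 + (- 1 / (2 * real m * \<Lambda>)) * \<alpha>"

lemma line_eq: fixes x :: real shows "\<Lambda> * x * line (\<Lambda> * x) = b * x * (2 * real m - x)"
  using \<Lambda>_pos m_pos by (simp add: line_def \<Lambda>_def field_simps)

text \<open>
  A single level \<open>i\<close> already contributes its logarithmic number of branches to the entropy at the
  exponent of that level.
\<close>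

lemma above_line:
  assumes "1 < i" "i < m" shows "line (\<Lambda> * real i) \<le> dim_formula (\<Lambda> * real i)"
proof -
  have rng: "\<Lambda> * real i \<in> {a_min<..<a_max}" using assms by (intro level_range) auto
  have "b * i * (2 * real m - i) \<le> pressure s + s * (\<Lambda> * i)" for s
  proof -
    have "exp (b * i * (2 * real m - i) - \<Lambda> * i * s) \<le> partition_sum s"
      unfolding partition_sum_levels
      by (rule member_le_sum[where f="\<lambda>i. exp (b * real i * (2 * real m - real i) - \<Lambda> * real i * s)"])
        (use assms in auto)
    then have "b * i * (2 * real m - i) - \<Lambda> * i * s \<le> pressure s"
      unfolding pressure_def by (subst ln_ge_iff[OF partition_sum_pos])
    then show ?thesis by (simp add: mult_ac)
  qed
  from dim_formula_ge[OF rng this]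
  have "\<Lambda> * i * line (\<Lambda> * i) \<le> \<Lambda> * i * dim_formula (\<Lambda> * i)" by (simp add: line_eq)
  then show ?thesis using \<Lambda>_pos assms by simp
qed

text \<open>
  At the midpoint the pressure is evaluated at the slope of the polygon's edge. There the two
  neighbouring levels dominate, every level being at most as large since
  \<open>(l - i) * (l - i - 1) \<ge> 0\<close> for integers; the \<open>m\<close> levels together cost the factor \<open>m\<close>.
\<close>

lemma below_line:
  assumes "1 \<le> i" "i < m" shows "dim_formula (\<Lambda> * (i + 1 / 2)) < line (\<Lambda> * (i + 1 / 2))"
proof -
  define x where "x = real i + 1 / 2"
  define s where "s = 1 - x / m"
  have "real (i + 1) \<le> m" using assms by linarith
  then have rng: "\<Lambda> * x \<in> {a_min<..<a_max}" using assms by (intro level_range) (auto simp: x_def)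
  have "exp (b * l * (2 * real m - l) - \<Lambda> * l * s) \<le> exp (b * (x\<^sup>2 - 1 / 4))" for l :: nat
  proof -
    have "0 \<le> (int l - int i) * (int l - int i - 1)" by (simp add: zero_le_mult_iff) linarith
    then have "0 \<le> real_of_int ((int l - int i) * (int l - int i - 1))" by (simp only: of_int_0_le_iff)
    then have "real l * (2 * x) - real l * real l \<le> x\<^sup>2 - 1 / 4"
      by (simp add: x_def power2_eq_square algebra_simps)
    then have "b * (real l * (2 * x) - real l * real l) \<le> b * (x\<^sup>2 - 1 / 4)" using b by simp
    moreover have "b * l * (2 * real m - l) - \<Lambda> * l * s = b * (real l * (2 * x) - real l * real l)"
      using m_pos by (simp add: \<Lambda>_def s_def field_simps)
    ultimately show ?thesis by simp
  qed
  then have "partition_sum s \<le> (\<Sum>l\<in>{1..m}. exp (b * (x\<^sup>2 - 1 / 4)))"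
    unfolding partition_sum_levels by (intro sum_mono) auto
  also have "\<dots> = exp (ln m + b * (x\<^sup>2 - 1 / 4))" using m_pos by (simp add: exp_add)
  finally have "pressure s \<le> ln m + b * (x\<^sup>2 - 1 / 4)"
    unfolding pressure_def using partition_sum_pos[of s] by (metis ln_exp ln_le_cancel_iff exp_gt_zero)
  moreover have "\<Lambda> * x * dim_formula (\<Lambda> * x) \<le> pressure s + s * (\<Lambda> * x)"
    by (rule dim_formula_le[OF rng])
  moreover have "b * (x\<^sup>2 - 1 / 4) + s * (\<Lambda> * x) = b * x * (2 * real m - x) - b / 4"
    using m_pos by (simp add: \<Lambda>_def s_def field_simps power2_eq_square)
  ultimately have "\<Lambda> * x * dim_formula (\<Lambda> * x) < \<Lambda> * x * line (\<Lambda> * x)"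
    using b line_eq[of x] by linarith
  then show ?thesis using \<Lambda>_pos by (simp add: x_def)
qed

text \<open>
  The spectrum is on or above the line at the left end and below it at the midpoint. The half-open
  interval keeps the crossings for different \<open>i\<close> apart.
\<close>

lemma crossing:
  assumes "1 < i" "i < m"
  shows "\<exists>z. \<Lambda> * i \<le> z \<and> z < \<Lambda> * (i + 1) \<and> z \<in> {a_min<..<a_max} \<and> dim_formula z = line z"
proof -
  obtain G where G: "\<And>\<alpha>. \<alpha> \<in> {a_min<..<a_max} \<Longrightarrow> G 0 \<alpha> = dim_formula \<alpha>"
    "\<And>j \<alpha>. \<alpha> \<in> {a_min<..<a_max} \<Longrightarrow> (G j has_real_derivative G (Suc j) \<alpha>) (at \<alpha>)"
    using dim_formula_smooth by blast
  let ?l = "\<Lambda> * i" and ?u = "\<Lambda> * (i + 1 / 2)"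
  have "real (i + 1) \<le> m" using assms by linarith
  then have "real i + 1 / 2 < m" by simp
  with assms have ends: "?l \<in> {a_min<..<a_max}" "?u \<in> {a_min<..<a_max}"
    using level_range[of "real i"] level_range[of "real i + 1 / 2"] by simp_all
  have "?l \<le> ?u" using \<Lambda>_pos by simp
  have sub: "z \<in> {a_min<..<a_max}" if "z \<in> {?l..?u}" for z using ends that by auto
  have "continuous_on {?l..?u} (\<lambda>z. G 0 z - line z)"
    unfolding line_def
    by (intro continuous_intros continuous_at_imp_continuous_on ballI DERIV_isCont[OF G(2)[OF sub]])
  moreover have "G 0 ?u - line ?u \<le> 0" "0 \<le> G 0 ?l - line ?l"
    using above_line[OF assms] below_line[of i] assms G(1) ends by auto
  ultimately obtain z where z: "?l \<le> z" "z \<le> ?u" "G 0 z - line z = 0"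
    using IVT2'[of "\<lambda>z. G 0 z - line z" ?u 0 ?l] \<open>?l \<le> ?u\<close> by auto
  moreover have "?u < \<Lambda> * (i + 1)" using \<Lambda>_pos by simp
  ultimately show ?thesis using G(1)[of z] sub[of z] by (intro exI[of _ z]) auto
qed

text \<open>
  The endpoints of the spectrum's domain lie at the levels \<open>1\<close> and \<open>m\<close>, so crossings are available
  for the \<open>m - 2\<close> levels in between; \<open>k\<close> applications of Rolle's theorem consume \<open>k\<close> of them.
\<close>

lemma many_zeros:
  assumes "2 \<le> k" "m = n + k + 2"
  shows "\<exists>Z. finite Z \<and> card Z = n \<and>
    Z \<subseteq> deriv_zeros k (lyapunov_spectrum q X T) (interior (lyapunov_values q X T))"
proof -
  obtain G where G: "\<And>\<alpha>. \<alpha> \<in> {a_min<..<a_max} \<Longrightarrow> G 0 \<alpha> = dim_formula \<alpha>"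
    "\<And>j \<alpha>. \<alpha> \<in> {a_min<..<a_max} \<Longrightarrow> (G j has_real_derivative G (Suc j) \<alpha>) (at \<alpha>)"
    using dim_formula_smooth by blast
  have "\<forall>i. \<exists>z. i < n + k \<longrightarrow> \<Lambda> * real (i + 2) \<le> z \<and> z < \<Lambda> * (real (i + 2) + 1) \<and>
      z \<in> {a_min<..<a_max} \<and> dim_formula z = line z"
  proof
    fix i
    show "\<exists>z. i < n + k \<longrightarrow> \<Lambda> * real (i + 2) \<le> z \<and> z < \<Lambda> * (real (i + 2) + 1) \<and>
      z \<in> {a_min<..<a_max} \<and> dim_formula z = line z"
    proof (cases "i < n + k")
      case True
      then show ?thesis using crossing[of "i + 2"] assms(2) by auto
    qed simp
  qed
  from choice[OF this] obtain z where z: "\<And>i. i < n + k \<Longrightarrow> \<Lambda> * real (i + 2) \<le> z i \<and> z i < \<Lambda> * (real (i + 2) + 1) \<and>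
      z i \<in> {a_min<..<a_max} \<and> dim_formula (z i) = line (z i)" by blast
  show ?thesis
    unfolding interior_lyapunov_values
  proof (rule deriv_zeros_if_line_intersections)
    show "open {a_min<..<a_max}" "is_interval {a_min<..<a_max}"
      by (auto simp: is_interval_1)
    show "(G j has_real_derivative G (Suc j) x) (at x)" if "x \<in> {a_min<..<a_max}" for j x
      by (rule G(2)[OF that])
    show "lyapunov_spectrum q X T x = G 0 x" if "x \<in> {a_min<..<a_max}" for x
      using lyapunov_spectrum_eq[OF that] G(1)[OF that] by simp
    show "2 \<le> k" by fact
    show "z i \<in> {a_min<..<a_max} \<and> lyapunov_spectrum q X T (z i) = 1 + (- 1 / (2 * real m * \<Lambda>)) * z i"
      if "i < n + k" for i
      using z[OF that] lyapunov_spectrum_eq[of "z i"] by (simp add: line_def)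
    show "z i < z (Suc i)" if "Suc i < n + k" for i
    proof -
      have "z i < \<Lambda> * (real (i + 2) + 1)" using z[of i] that by auto
      also have "\<Lambda> * (real (i + 2) + 1) = \<Lambda> * real (Suc i + 2)" by simp
      also have "\<dots> \<le> z (Suc i)" using z[OF that] by blast
      finally show ?thesis .
    qed
  qed
qed

end

lemma geometric_square_sum_less_1:
  fixes t :: real
  assumes "0 \<le> t" "t \<le> 1 / 2"
  shows "(\<Sum>i\<in>{1..m}. t ^ (i * i)) < 1"
proof -
  have "(\<Sum>i\<in>{1..m}. t ^ (i * i)) \<le> (\<Sum>i\<in>{1..m}. (1 / 2) ^ i)"
  proof (intro sum_mono)
    fix i assume "i \<in> {1..m}"
    then have "t ^ (i * i) \<le> t ^ i" using assms by (intro power_decreasing) auto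
    also have "\<dots> \<le> (1 / 2) ^ i" using assms by (intro power_mono) auto
    finally show "t ^ (i * i) \<le> (1 / 2) ^ i" .
  qed
  also have "\<dots> = 1 - (1 / 2) ^ m" by (induction m) auto
  also have "\<dots> < 1" by simp
  finally show ?thesis .
qed

text \<open>
  Powers of an integer \<open>B\<close> realise the numbers of branches exactly, with \<open>b = ln B\<close>. Any \<open>B\<close> above
  \<open>m ^ 4\<close> makes \<open>ln m < b / 4\<close>; a bijection with an interval of integers numbers the branches.
\<close>

lemma parabolic_levels_exist:
  fixes m :: nat
  assumes "2 \<le> m"
  obtains q r b lev where "parabolic_levels q r m b lev"
proof -
  define B where "B = m ^ 5"
  define b where "b = ln (real B)"
  define N where "N i = B ^ (i * (2 * m - i))" for i
  have "m ^ 1 \<le> B" unfolding B_def using assms by (intro power_increasing) auto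
  then have B: "2 \<le> B" using assms by simp
  have expb: "exp (b * real l) = real B ^ l" for l
    using B by (simp add: b_def exp_of_nat2_mult)
  define A where "A = (SIGMA i:{1..m}. {..<N i})"
  have "finite A" by (simp add: A_def)
  then obtain h where h: "bij_betw h {1..card A} A" using ex_bij_betw_nat_finite_1 by blast
  define q where "q = card A"
  define lev where "lev j = fst (h j)" for j
  define r where "r j = exp (- 2 * real m * b * lev j)" for j
  have card_lev: "card {j \<in> {1..q}. lev j = i} = N i" if "i \<in> {1..m}" for i
  proof -
    have "bij_betw h {j \<in> {1..q}. lev j = i} ({i} \<times> {..<N i})"
    proof (rule bij_betw_subset[OF h])
      show "{j \<in> {1..q}. lev j = i} \<subseteq> {1..card A}" by (auto simp: q_def)
      show "h ` {j \<in> {1..q}. lev j = i} = {i} \<times> {..<N i}"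
      proof
        show "h ` {j \<in> {1..q}. lev j = i} \<subseteq> {i} \<times> {..<N i}"
        proof
          fix p assume "p \<in> h ` {j \<in> {1..q}. lev j = i}"
          then obtain j where "j \<in> {1..card A}" "fst (h j) = i" "p = h j" by (auto simp: q_def lev_def)
          moreover from this have "h j \<in> A" using bij_betwE[OF h] by blast
          ultimately show "p \<in> {i} \<times> {..<N i}" by (auto simp: A_def)
        qed
        show "{i} \<times> {..<N i} \<subseteq> h ` {j \<in> {1..q}. lev j = i}"
        proof
          fix p assume p: "p \<in> {i} \<times> {..<N i}"
          then have "p \<in> A" using that by (auto simp: A_def)
          then obtain j where "j \<in> {1..card A}" "p = h j" using h unfolding bij_betw_def by blast
          then show "p \<in> h ` {j \<in> {1..q}. lev j = i}" using p by (auto simp: lev_def q_def)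
        qed
      qed
    qed
    from bij_betw_same_card[OF this] show ?thesis by (simp add: card_cartesian_product)
  qed
  have lev_sub: "lev ` {1..q} \<subseteq> {1..m}"
  proof
    fix i assume "i \<in> lev ` {1..q}"
    then obtain j where "j \<in> {1..card A}" "i = fst (h j)" by (auto simp: lev_def q_def)
    moreover from this have "h j \<in> A" using bij_betwE[OF h] by blast
    ultimately show "i \<in> {1..m}" by (auto simp: A_def)
  qed
  have N_pos: "0 < N i" for i using B by (simp add: N_def)
  have lev_eq: "lev ` {1..q} = {1..m}"
  proof
    show "{1..m} \<subseteq> lev ` {1..q}"
    proof
      fix i assume "i \<in> {1..m}"
      then have "card {j \<in> {1..q}. lev j = i} \<noteq> 0" using card_lev N_pos[of i] by simp
      then have "{j \<in> {1..q}. lev j = i} \<noteq> {}" by (metis card.empty)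
      then show "i \<in> lev ` {1..q}" by blast
    qed
  qed (rule lev_sub)
  have Nexp: "real (N i) = exp (b * i * (2 * real m - i))" if "i \<in> {1..m}" for i
    using that expb[of "i * (2 * m - i)"] by (simp add: N_def of_nat_diff mult.assoc)
  have "(\<Sum>j\<in>{1..q}. r j) = (\<Sum>i\<in>{1..m}. real (card {j \<in> {1..q}. lev j = i}) * exp (- 2 * real m * b * i))"
    unfolding r_def using lev_sub
    by (intro sum_over_levels[where F="\<lambda>i. exp (- 2 * real m * b * real i)"]) auto
  also have "\<dots> = (\<Sum>i\<in>{1..m}. (1 / real B) ^ (i * i))"
  proof (intro sum.cong refl)
    fix i assume i: "i \<in> {1..m}"
    have "real (card {j \<in> {1..q}. lev j = i}) * exp (- 2 * real m * b * i)
        = exp (b * i * (2 * real m - i) + - 2 * real m * b * i)"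
      unfolding card_lev[OF i] Nexp[OF i] exp_add ..
    also have "b * i * (2 * real m - i) + - 2 * real m * b * i = - (b * real (i * i))"
      by (simp add: algebra_simps)
    also have "exp (- (b * real (i * i))) = (1 / real B) ^ (i * i)"
      unfolding exp_minus expb by (simp add: power_inverse divide_inverse)
    finally show "real (card {j \<in> {1..q}. lev j = i}) * exp (- 2 * real m * b * i) = (1 / real B) ^ (i * i)" .
  qed
  also have "\<dots> < 1" using B by (intro geometric_square_sum_less_1) (auto simp: field_simps)
  finally have sum: "(\<Sum>j\<in>{1..q}. r j) < 1" .
  have b: "0 < b" using B by (simp add: b_def)
  have b5: "b = 5 * ln (real m)" using assms by (simp add: b_def B_def ln_realpow)
  have "card {1..m} \<le> card {1..q}"
    using surj_card_le[of "{1..q}" "{1..m}" lev] lev_eq by simp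
  then have q: "2 \<le> q" using assms by simp
  have "parabolic_levels q r m b lev"
  proof
    show "2 \<le> q" "(\<Sum>j\<in>{1..q}. r j) < 1" "0 < b" "lev ` {1..q} = {1..m}" by fact+
    show "0 < r j" for j by (simp add: r_def)
    show "ln (real m) < b / 4" using b b5 by simp
    show "r j = exp (- 2 * real m * b * lev j)" for j by (simp add: r_def)
    show "real (card {j \<in> {1..q}. lev j = i}) = exp (b * i * (2 * real m - i))" if "i \<in> {1..m}" for i
      using card_lev[OF that] Nexp[OF that] by simp
    have "1 \<in> lev ` {1..q}" "2 \<in> lev ` {1..q}" unfolding lev_eq using assms by auto
    then obtain j k where jk: "j \<in> {1..q}" "lev j = 1" "k \<in> {1..q}" "lev k = 2"
      by (metis imageE)
    then have "r k < r j" using b assms by (simp add: r_def)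
    then show "\<exists>i\<in>{1..q}. \<exists>j\<in>{1..q}. r i < r j" using jk by blast
  qed
  then show thesis by (rule that)
qed

theorem corollary1p5:
  fixes n k :: nat
  assumes "k \<ge> 2"
  shows "\<exists>q X T. piecewise_linear_map q X T \<and>
           (\<exists>Z. finite Z \<and> card Z = n \<and>
                Z \<subseteq> deriv_zeros k (lyapunov_spectrum q X T) (interior (lyapunov_values q X T)))"
proof -
  obtain q r b lev where "parabolic_levels q r (n + k + 2) b lev"
    using parabolic_levels_exist[of "n + k + 2"] by (metis le_add2)
  then interpret parabolic_levels q r "n + k + 2" b lev .
  show ?thesis using piecewise_linear many_zeros[OF assms refl] by blast
qed

end
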